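(* Let $n,d\ge 1$ be integers and let $C\neq 0$ be a real symmetric positive semidefinite $d\times d$ matrix. Let $S$ follow the Wishart distribution $\mathcal{W}_d(n,C)$. Let $r=\operatorname{tr}(C)/\|C\|$. Then for every $\theta\ge 0$, $$\Pr\left\{\lambda_1\left(\tfrac{1}{n}S-C\right)\ge\left(\sqrt{\frac{2\theta(r+1)}{n}}+\frac{2\theta r}{n}\right)\lambda_1(C)\right\}\le d\exp\{-\theta\},$$ $$\Pr\left\{\lambda_1\left(C-\tfrac{1}{n}S\right)\ge\left(\sqrt{\frac{2\theta(r+1)}{n}}+\frac{2\theta r}{n}\right)\lambda_1(C)\right\}\le d\exp\{-\theta\},$$ $$\Pr\left\{\left\|\tfrac{1}{n}S-C\right\|\ge\left(\sqrt{\frac{2\theta(r+1)}{n}}+\frac{2\theta r}{n}\right)\|C\|\right\}\le 2d\exp\{-\theta\},$$ and, if moreover $\lambda_d(C)>0$ (so that the condition numbers $\kappa_\ell=\lambda_1(C)/\lambda_\ell(C)$ are defined for all $\ell\in\{1,\dots,d\}$), $$\Pr\left\{\left|\lambda_\ell\left(\tfrac{1}{n}S\right)-\lambda_\ell(C)\right|\ge\left(\sqrt{\frac{2\theta\kappa_\ell^2(r+1)}{n}}+\frac{2\theta\kappa_\ell r}{n}\right)\lambda_\ell(C)\ \text{ for all }\ell\in\{1,\dots,d\}\right\}\le 2d\exp\{-\theta\}.$$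
   Context: For a real symmetric $d\times d$ matrix $X$, $\lambda_\ell(X)$ denotes its $\ell$-th largest eigenvalue (so $\lambda_1$ is the largest and $\lambda_d$ the smallest), $\operatorname{tr}(X)$ its trace and $\|X\|$ its spectral norm. The Wishart distribution $\mathcal{W}_d(n,C)$ is the distribution of the scatter matrix $S=\sum_{k=1}^n \xi_k\xi_k^{\top}$, where $\xi_1,\dots,\xi_n$ are independent random vectors in $\mathbb{R}^d$, each with the centered multivariate normal distribution $\mathcal{N}_d(0,C)$ with covariance matrix $C$. *)

theory Defs
  imports "HOL-Probability.Probability" "HOL-Library.Multiset"
begin

definition symmetric_mat :: "real^'d^'d \<Rightarrow> bool" where
  "symmetric_mat X \<longleftrightarrow> transpose X = X"

definition pos_semidef :: "real^'d^'d \<Rightarrow> bool" where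
  "pos_semidef X \<longleftrightarrow> (\<forall>v. 0 \<le> v \<bullet> (X *v v))"

definition eigenspace :: "real^'d^'d \<Rightarrow> real \<Rightarrow> (real^'d) set" where
  "eigenspace X \<mu> = {v. X *v v = \<mu> *\<^sub>R v}"

definition eigenvalues :: "real^'d^'d \<Rightarrow> real set" where
  "eigenvalues X = {\<mu>. \<exists>v. v \<noteq> 0 \<and> X *v v = \<mu> *\<^sub>R v}"

(* Each eigenvalue is repeated according to the dimension of its eigenspace.
   For symmetric X this is also its algebraic multiplicity, and the multiset
   has exactly CARD('d) elements. *)
definition eigenvalue_mset :: "real^'d^'d \<Rightarrow> real multiset" where
  "eigenvalue_mset X = (\<Sum>\<mu>\<in>eigenvalues X. replicate_mset (dim (eigenspace X \<mu>)) \<mu>)"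

(* The l-th largest eigenvalue, counted with multiplicity and from 1: eigval 1 X is
   the largest and eigval CARD('d) X the smallest eigenvalue of a symmetric X.
   Only meaningful for symmetric X and 1 <= l <= CARD('d). *)
definition eigval :: "nat \<Rightarrow> real^'d^'d \<Rightarrow> real" where
  "eigval l X = rev (sorted_list_of_multiset (eigenvalue_mset X)) ! (l - 1)"

(* The norm of the type real^'d^'d is the Frobenius norm, hence onorm. *)
definition spectral_norm :: "real^'d^'d \<Rightarrow> real" where
  "spectral_norm X = onorm (\<lambda>v. X *v v)"

definition std_mv_normal :: "(real^'d) measure" where
  "std_mv_normal =
     distr (\<Pi>\<^sub>M i\<in>(UNIV :: 'd set). density lborel std_normal_density) borel (\<lambda>z. \<chi> i. z i)"

(* N(0, C) for symmetric positive semidefinite, possibly singular C: the law of A Z with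
   Z standard normal and A A^T = C. Such an A exists, and the law depends on C only. *)
definition mv_normal :: "real^'d^'d \<Rightarrow> (real^'d) measure" where
  "mv_normal C = distr (std_mv_normal :: (real^'d) measure) borel (\<lambda>z. (SOME A :: real^'d^'d. A ** transpose A = C) *v z)"

definition scatter_matrix :: "nat \<Rightarrow> (nat \<Rightarrow> real^'d) \<Rightarrow> real^'d^'d" where
  "scatter_matrix n \<xi> = (\<Sum>k<n. \<chi> i j. \<xi> k $ i * \<xi> k $ j)"

(* Independence of the n normal vectors is the product measure. *)
definition wishart :: "nat \<Rightarrow> real^'d^'d \<Rightarrow> (real^'d^'d) measure" where
  "wishart n C = distr (\<Pi>\<^sub>M k\<in>{..<n}. mv_normal C) borel (scatter_matrix n)"

end

theory Submission
  imports Defs "HOL-Computational_Algebra.Polynomial"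
begin

text \<open>
  For \<open>X = \<xi> \<xi>\<^sup>T - C\<close> the matrix Laplace transform is controlled by comparing \<open>exp (l X)\<close> with
  \<open>1 + l X + \<phi> X\<^sup>2\<close>, where \<open>\<phi>\<close> may be taken as a power series in \<open>|\<xi>|\<^sup>2\<close> because \<open>X \<le> |\<xi>|\<^sup>2\<close>
  (and in \<open>\<lambda>\<^sub>1(C)\<close> for \<open>- X \<le> C\<close>). Stein's identity gives \<open>E |\<xi>|\<^bsup>2q\<^esup> X\<^sup>2 \<le>
  (q + 2)! / 2 (2r)\<^sup>q (r + 1) \<lambda>\<^sub>1(C)\<^bsup>q+2\<^esup>\<close>, a Bernstein condition with variance \<open>r + 1\<close> and scale \<open>2r\<close>.
  As the summands are identically distributed, the Ahlswede-Winter argument, which needs only the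
  Golden-Thompson inequality, already gives the dimension factor \<open>d\<close>. The bound for
  all eigenvalues simultaneously follows from \<open>\<ell> = 1\<close> alone, where \<open>\<kappa>\<^sub>1 = 1\<close>.
\<close>

section \<open>Spectral theory of symmetric matrices\<close>

text \<open>The obstacle is that \<open>outer \<xi> - C\<close> is unbounded above, so a Bernstein
  argument with a deterministic bound does not apply; a random bound costs only moments, which
  Stein's identity computes. No matrix-valued integral appears: estimates in the semidefinite order
  are scalar statements about \<open>v \<bullet> (X *v v)\<close> for a fixed \<open>v\<close>, and
  functions of a symmetric matrix act on its eigenvalues in a fixed orthonormal basis. The transform
  is at most \<open>1 + K\<close> times the identity. This scalar form permits the product over the
  sample: integrating out one summand multiplies the trace by a number, so nothing has to commute.
  With \<open>x = l * eigval 1 C\<close> one gets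
  \<open>K = x\<^sup>2 * (r + 1) / (2 * (1 - 2 * r * x))\<close>, the sum of a geometric series of
  ratio \<open>2 * r * x\<close>, and minimising \<open>n * K - n * x * t\<close> gives exactly the
  two terms of the deviation threshold. The effective rank satisfies \<open>r \<ge> 1\<close>, which
  lets additive constants be absorbed into multiples of \<open>r\<close>.\<close>

lemma nonneg_quadratic_imp_zero:
  fixes b c :: real
  assumes "\<And>t. 0 \<le> 2 * t * b + t\<^sup>2 * c"
  shows "b = 0"
proof (cases "c = 0")
  case True
  then show ?thesis using assms[of 1] assms[of "-1"] by simp
next
  case False
  have c: "c > 0" using assms[of 1] assms[of "-1"] False by simp
  have "2 * (- b / c) * b + (- b / c)\<^sup>2 * c = - (b\<^sup>2 / c)"
    using False by (simp add: power2_eq_square field_simps)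
  then have "b\<^sup>2 / c \<le> 0" using assms[of "- b / c"] by simp
  then have "b\<^sup>2 \<le> 0" using c by (simp add: divide_le_0_iff)
  then show ?thesis by simp
qed

text \<open>A maximiser \<open>w\<close> of the Rayleigh quotient on the unit sphere of
  \<open>V\<close> is an eigenvector: the form \<open>l * (x \<bullet> x) - x \<bullet> f x\<close>
  is nonnegative on \<open>V\<close> and zero at \<open>w\<close>, so its first variation there
  vanishes.\<close>

lemma self_adjoint_eigenvector_in_subspace:
  fixes f :: "'a::euclidean_space \<Rightarrow> 'a"
  assumes lin: "linear f" and sym: "\<And>x y. f x \<bullet> y = x \<bullet> f y"
    and V: "subspace V" "f ` V \<subseteq> V" "V \<noteq> {0}"
  shows "\<exists>w\<in>V. norm w = 1 \<and> (\<exists>l. f w = l *\<^sub>R w)"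
proof -
  define S where "S = V \<inter> sphere 0 1"
  have "compact S" unfolding S_def
    using closed_Int_compact[OF closed_subspace[OF V(1)] compact_sphere] .
  moreover obtain v where v: "v \<in> V" "v \<noteq> 0" using V subspace_0 by blast
  then have "(1 / norm v) *\<^sub>R v \<in> S" unfolding S_def
    by (auto intro: subspace_scale[OF V(1)])
  then have "S \<noteq> {}" by auto
  moreover have "continuous_on S (\<lambda>x. x \<bullet> f x)"
    by (intro continuous_intros linear_continuous_on linear_conv_bounded_linear[THEN iffD1] lin)
  ultimately obtain w where w: "w \<in> S" "\<And>x. x \<in> S \<Longrightarrow> x \<bullet> f x \<le> w \<bullet> f w"
    using continuous_attains_sup by metis
  define l where "l = w \<bullet> f w"
  have wV: "w \<in> V" "norm w = 1" using w by (auto simp: S_def)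
  have le: "x \<bullet> f x \<le> l * (x \<bullet> x)" if "x \<in> V" for x
  proof (cases "x = 0")
    case True then show ?thesis by simp
  next
    case False
    then have "(1 / norm x) *\<^sub>R x \<in> S" unfolding S_def
      using that by (auto intro: subspace_scale[OF V(1)])
    from w(2)[OF this] have "(x \<bullet> f x) / (norm x)\<^sup>2 \<le> l"
      by (simp add: linear_scale[OF lin] l_def power2_eq_square divide_simps)
    then show ?thesis using False by (simp add: divide_simps power2_norm_eq_inner)
  qed
  \<comment> \<open>\<open>h\<close> is the residual of the eigenvector equation. Invariance of
    \<open>V\<close> keeps \<open>w + t *\<^sub>R h\<close> inside \<open>V\<close>, and the linear
    coefficient of the form in this direction is twice \<open>h \<bullet> h\<close>.\<close>
  define h where "h = l *\<^sub>R w - f w"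
  have h: "h \<in> V" unfolding h_def using V wV
    by (auto intro!: subspace_diff subspace_scale)
  have "h \<bullet> h = 0"
  proof (rule nonneg_quadratic_imp_zero)
    fix t :: real
    have "w + t *\<^sub>R h \<in> V" using V wV h by (auto intro!: subspace_add subspace_scale)
    from le[OF this]
    have *: "0 \<le> l * ((w + t *\<^sub>R h) \<bullet> (w + t *\<^sub>R h)) - (w + t *\<^sub>R h) \<bullet> f (w + t *\<^sub>R h)" by simp
    have sq: "w \<bullet> w = 1" using wV by (simp add: norm_eq_1)
    have "f w \<bullet> h = h \<bullet> f w" "w \<bullet> f h = f w \<bullet> h" using sym by (auto simp: inner_commute)
    then have "l * ((w + t *\<^sub>R h) \<bullet> (w + t *\<^sub>R h)) - (w + t *\<^sub>R h) \<bullet> f (w + t *\<^sub>R h)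
        = 2 * t * (l * (w \<bullet> h) - f w \<bullet> h) + t\<^sup>2 * (l * (h \<bullet> h) - h \<bullet> f h)"
      by (simp add: linear_add[OF lin] linear_scale[OF lin] inner_add algebra_simps
          power2_eq_square inner_commute[of h w] l_def sq)
    also have "l * (w \<bullet> h) - f w \<bullet> h = h \<bullet> h" by (metis h_def inner_diff_left inner_scaleR_left)
    finally show "0 \<le> 2 * t * (h \<bullet> h) + t\<^sup>2 * (l * (h \<bullet> h) - h \<bullet> f h)" using * by simp
  qed
  then have "f w = l *\<^sub>R w" by (simp add: h_def)
  then show ?thesis using wV by blast
qed

text \<open>An orthonormal set of eigenvectors of largest cardinality must span: its orthogonal
  complement is invariant because \<open>f\<close> is self-adjoint, so if nonzero it would contain
  one more unit eigenvector.\<close>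

lemma self_adjoint_orthonormal_eigenbasis:
  fixes f :: "'a::euclidean_space \<Rightarrow> 'a"
  assumes lin: "linear f" and sym: "\<And>x y. f x \<bullet> y = x \<bullet> f y"
  shows "\<exists>B. pairwise orthogonal B \<and> (\<forall>x\<in>B. norm x = 1 \<and> (\<exists>c. f x = c *\<^sub>R x)) \<and> card B = DIM('a)"
proof -
  define P where "P B \<longleftrightarrow> pairwise orthogonal B \<and> (\<forall>x\<in>B. norm x = 1 \<and> (\<exists>c. f x = c *\<^sub>R x))" for B
  have ind: "independent B" if "P B" for B
    using that unfolding P_def by (intro pairwise_orthogonal_independent) auto
  have bound: "card B \<le> DIM('a)" "finite B" if "P B" for B
    using independent_bound[OF ind[OF that]] by auto
  have "\<exists>B. P B \<and> (\<forall>B'. P B' \<longrightarrow> card B' \<le> card B)"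
    by (rule ex_has_greatest_nat[where k="{}" and b="Suc DIM('a)"]) (use bound in \<open>auto simp: P_def le_imp_less_Suc\<close>)
  then obtain B where B: "P B" and max: "\<And>B'. P B' \<Longrightarrow> card B' \<le> card B" by blast
  define V where "V = {x. \<forall>b\<in>B. b \<bullet> x = 0}"
  have V: "subspace V" unfolding V_def subspace_def by (auto simp: inner_right_distrib)
  have inv: "f ` V \<subseteq> V"
  proof (clarsimp simp: V_def)
    fix x b assume x: "\<forall>b\<in>B. b \<bullet> x = 0" and b: "b \<in> B"
    obtain c where "f b = c *\<^sub>R b" using B b by (auto simp: P_def)
    then show "b \<bullet> f x = 0" using sym[of b x] x b by simp
  qed
  have "V = {0}"
  proof (rule ccontr)
    assume "V \<noteq> {0}"
    from self_adjoint_eigenvector_in_subspace[OF lin sym V inv this]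
    obtain w l where w: "w \<in> V" "norm w = 1" "f w = l *\<^sub>R w" by blast
    have "w \<notin> B" using w by (auto simp: V_def dest!: bspec[of _ _ w] simp: norm_eq_1)
    moreover have "P (insert w B)" unfolding P_def
      using B w by (auto simp: P_def pairwise_insert orthogonal_def V_def inner_commute)
    ultimately show False using max[of "insert w B"] bound[OF B] by simp
  qed
  have "span B = UNIV"
  proof (rule ccontr)
    assume "span B \<noteq> UNIV"
    from span_not_UNIV_orthogonal[OF this] obtain a where "a \<noteq> 0" "\<forall>x\<in>span B. a \<bullet> x = 0" by blast
    then have "a \<in> V" by (auto simp: V_def inner_commute span_base)
    then show False using \<open>V = {0}\<close> \<open>a \<noteq> 0\<close> by auto
  qed
  then have "card B = DIM('a)"
    using dim_eq_card_independent[OF ind[OF B]] dim_span[of B] by simp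
  then show ?thesis using B unfolding P_def by blast
qed

text \<open>Eigenvectors are indexed by the coordinate type \<open>'d\<close>, so repeated
  eigenvalues need no bookkeeping, and one family \<open>u\<close> serves \<open>A\<close>, its
  powers and its exponential: functional calculus changes \<open>a\<close> alone.\<close>

definition eigbasis :: "real^'d^'d \<Rightarrow> ('d \<Rightarrow> real^'d) \<Rightarrow> ('d \<Rightarrow> real) \<Rightarrow> bool" where
  "eigbasis A u a \<longleftrightarrow> (\<forall>i j. u i \<bullet> u j = (if i = j then 1 else 0)) \<and> (\<forall>i. A *v u i = a i *\<^sub>R u i)"

lemma minus_matrix_mult_vec: "- A *v x = - (A *v x)" for A :: "real^'d^'d"
  by (simp add: vec_eq_iff matrix_vector_mult_def sum_negf)

lemma symmetric_mat_inner:
  "symmetric_mat A \<Longrightarrow> (A *v x) \<bullet> y = x \<bullet> (A *v y)"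
  by (metis dot_lmul_matrix symmetric_mat_def transpose_matrix_vector)

theorem symmetric_mat_eigbasis:
  fixes A :: "real^'d^'d"
  assumes "symmetric_mat A"
  obtains u a where "eigbasis A u a"
proof -
  obtain B where B: "pairwise orthogonal B" "\<And>x. x \<in> B \<Longrightarrow> norm x = 1"
    "\<And>x. x \<in> B \<Longrightarrow> \<exists>c. A *v x = c *\<^sub>R x" "card B = CARD('d)"
    using self_adjoint_orthonormal_eigenbasis[of "(*v) A"] symmetric_mat_inner[OF assms] by auto
  have "finite B" using B(4) by (metis card.infinite zero_less_card_finite less_numeral_extra(3))
  then obtain u where u: "bij_betw u (UNIV::'d set) B"
    using B(4) finite_same_card_bij[of "UNIV::'d set" B] by auto
  have uB: "u i \<in> B" for i using u by (auto simp: bij_betw_def)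
  obtain a where a: "\<And>i. A *v u i = a i *\<^sub>R u i" using B(3)[OF uB] by metis
  have "u i \<bullet> u j = (if i = j then 1 else 0)" for i j
  proof (cases "i = j")
    case True then show ?thesis using B(2)[OF uB] by (simp add: norm_eq_1)
  next
    case False
    then have "u i \<noteq> u j" using u by (auto simp: bij_betw_def inj_on_def)
    then show ?thesis using B(1) uB False unfolding pairwise_def orthogonal_def by simp
  qed
  then have "eigbasis A u a" using a unfolding eigbasis_def by simp
  then show ?thesis using that by blast
qed

lemma eigbasisD:
  assumes "eigbasis A u a"
  shows "u i \<bullet> u j = (if i = j then 1 else 0)" "A *v u i = a i *\<^sub>R u i" "norm (u i) = 1" "u i \<noteq> 0"
  using assms unfolding eigbasis_def by (auto simp: norm_eq_1 dest!: spec[of _ i])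

lemma eigbasis_expansion:
  fixes A :: "real^'d^'d"
  assumes e: "eigbasis A u a"
  shows "x = (\<Sum>i\<in>UNIV. (u i \<bullet> x) *\<^sub>R u i)"
proof -
  have inj: "inj u" by (rule injI) (metis e eigbasisD(1) zero_neq_one)
  have orth: "pairwise orthogonal (range u)"
    using e inj by (auto simp: pairwise_def orthogonal_def eigbasis_def inj_def)
  have "independent (range u)"
    using pairwise_orthogonal_independent[OF orth] eigbasisD(4)[OF e] by (metis imageE)
  moreover have "card (range u) = dim (UNIV :: (real^'d) set)"
    using inj by (simp add: card_image)
  ultimately have "span (range u) = UNIV"
    by (metis card_ge_dim_independent order_refl top.extremum_unique subset_UNIV dim_UNIV)
  define y where "y = x - (\<Sum>i\<in>UNIV. (u i \<bullet> x) *\<^sub>R u i)"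
  have "orthogonal y v" if "v \<in> range u" for v
  proof -
    from that obtain j where v: "v = u j" by blast
    have "(\<Sum>i\<in>UNIV. (u i \<bullet> x) *\<^sub>R u i) \<bullet> u j = (\<Sum>i\<in>UNIV. if i = j then u i \<bullet> x else 0)"
      unfolding inner_sum_left by (rule sum.cong) (auto simp: eigbasisD(1)[OF e])
    also have "\<dots> = u j \<bullet> x" by simp
    finally show ?thesis unfolding orthogonal_def v y_def by (simp add: inner_diff inner_commute)
  qed
  then have "orthogonal y y"
    using orthogonal_to_span[of y "range u" y] \<open>span (range u) = UNIV\<close> by auto
  then show ?thesis by (simp add: y_def orthogonal_def)
qed

lemma eigbasis_inner:
  fixes A :: "real^'d^'d"
  assumes "eigbasis A u a"
  shows "x \<bullet> y = (\<Sum>i\<in>UNIV. (u i \<bullet> x) * (u i \<bullet> y))"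
  by (subst eigbasis_expansion[OF assms, of x]) (simp add: inner_sum_left)

lemma eigbasis_mult_vec:
  fixes A :: "real^'d^'d"
  assumes e: "eigbasis A u a"
  shows "u i \<bullet> (A *v x) = a i * (u i \<bullet> x)"
proof -
  have "A *v x = (\<Sum>j\<in>UNIV. (u j \<bullet> x) *\<^sub>R (a j *\<^sub>R u j))"
    by (subst eigbasis_expansion[OF e, of x])
      (simp add: linear_sum[OF matrix_vector_mul_linear] linear_scale[OF matrix_vector_mul_linear] eigbasisD(2)[OF e])
  then have "u i \<bullet> (A *v x) = u i \<bullet> (\<Sum>j\<in>UNIV. (u j \<bullet> x) *\<^sub>R (a j *\<^sub>R u j))" by (rule arg_cong)
  also have "\<dots> = (\<Sum>j\<in>UNIV. if i = j then a j * (u j \<bullet> x) else 0)"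
    unfolding inner_sum_right by (intro sum.cong refl) (simp add: eigbasisD(1)[OF e])
  finally show ?thesis by simp
qed

lemma eigbasis_inner_mult_vec:
  fixes A :: "real^'d^'d"
  assumes e: "eigbasis A u a"
  shows "x \<bullet> (A *v y) = (\<Sum>i\<in>UNIV. a i * (u i \<bullet> x) * (u i \<bullet> y))"
  by (subst eigbasis_inner[OF e]) (simp add: eigbasis_mult_vec[OF e] mult_ac)

text \<open>Basis independence of the trace: \<open>A\<close> supplies the orthonormal basis while
  \<open>B\<close> is arbitrary. This is what later evaluates the trace of a product of two
  exponentials in an eigenbasis of one factor.\<close>

lemma eigbasis_trace:
  fixes A B :: "real^'d^'d"
  assumes e: "eigbasis A u a"
  shows "trace B = (\<Sum>i\<in>UNIV. u i \<bullet> (B *v u i))"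
proof -
  have "trace B = (\<Sum>k\<in>UNIV. axis k 1 \<bullet> (B *v axis k 1))"
    unfolding trace_def by (simp add: matrix_vector_mult_basis inner_axis' column_def)
  also have "\<dots> = (\<Sum>k\<in>UNIV. \<Sum>i\<in>UNIV. (u i \<bullet> axis k 1) * (u i \<bullet> (B *v axis k 1)))"
    by (subst eigbasis_inner[OF e]) simp
  also have "\<dots> = (\<Sum>i\<in>UNIV. \<Sum>k\<in>UNIV. (u i \<bullet> axis k 1) * (u i \<bullet> (B *v axis k 1)))"
    by (rule sum.swap)
  also have "\<dots> = (\<Sum>i\<in>UNIV. u i \<bullet> (B *v u i))"
  proof (rule sum.cong[OF refl])
    fix i
    have "u i = (\<Sum>k\<in>UNIV. (u i $ k) *\<^sub>R axis k 1)"
      using basis_expansion[of "u i"] by (simp add: scalar_mult_eq_scaleR)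
    then have "u i \<bullet> (B *v u i) = u i \<bullet> (B *v (\<Sum>k\<in>UNIV. (u i $ k) *\<^sub>R axis k 1))" by simp
    also have "\<dots> = (\<Sum>k\<in>UNIV. (u i $ k) * (u i \<bullet> (B *v axis k 1)))"
      by (simp add: linear_sum[OF matrix_vector_mul_linear] linear_scale[OF matrix_vector_mul_linear] inner_sum_right)
    finally show "(\<Sum>k\<in>UNIV. (u i \<bullet> axis k 1) * (u i \<bullet> (B *v axis k 1))) = u i \<bullet> (B *v u i)"
      by (simp add: inner_axis)
  qed
  finally show ?thesis .
qed

section \<open>Largest eigenvalue, Rayleigh quotient and spectral norm\<close>

lemma eigbasis_eigenvalues:
  fixes A :: "real^'d^'d"
  assumes e: "eigbasis A u a"
  shows "eigenvalues A = range a"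
proof (intro set_eqI iffI)
  fix \<mu> assume "\<mu> \<in> eigenvalues A"
  then obtain v where v: "v \<noteq> 0" "A *v v = \<mu> *\<^sub>R v" by (auto simp: eigenvalues_def)
  have "\<exists>i. u i \<bullet> v \<noteq> 0"
  proof (rule ccontr)
    assume "\<nexists>i. u i \<bullet> v \<noteq> 0"
    then have "(\<Sum>i\<in>UNIV. (u i \<bullet> v) *\<^sub>R u i) = 0" by simp
    then show False using eigbasis_expansion[OF e, of v] v(1) by metis
  qed
  then obtain i where "u i \<bullet> v \<noteq> 0" by blast
  then have "\<mu> = a i" using eigbasis_mult_vec[OF e, of i v] v(2) by simp
  then show "\<mu> \<in> range a" by blast
next
  fix \<mu> assume "\<mu> \<in> range a"
  then show "\<mu> \<in> eigenvalues A" unfolding eigenvalues_def using eigbasisD(2,4)[OF e] by blast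
qed

text \<open>\<open>eigval\<close> sorts a multiset, but at index 1 it sees only the largest element,
  so it suffices that every eigenvalue occurs at least once, that is, that its eigenspace has
  nonzero dimension.\<close>

lemma eigbasis_eigval_1:
  fixes A :: "real^'d^'d"
  assumes e: "eigbasis A u a"
  shows "eigval 1 A = Max (range a)"
proof -
  let ?M = "eigenvalue_mset A"
  have fin: "finite (eigenvalues A)" by (simp add: eigbasis_eigenvalues[OF e])
  have dim: "dim (eigenspace A \<mu>) \<noteq> 0" if "\<mu> \<in> eigenvalues A" for \<mu>
    using that unfolding dim_eq_0 eigenvalues_def eigenspace_def by auto
  have set: "set_mset ?M = range a" unfolding eigenvalue_mset_def
    using dim by (auto simp: set_mset_sum fin eigbasis_eigenvalues[OF e] split: if_splits)
  define xs where "xs = sorted_list_of_multiset ?M"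
  have xs: "sorted xs" "set xs = range a"
    unfolding xs_def using set by (auto simp: sorted_sorted_list_of_multiset)
  have ne: "xs \<noteq> []" using xs(2) by (metis empty_not_UNIV image_is_empty set_empty)
  have last: "eigval 1 A = last xs" unfolding eigval_def xs_def[symmetric]
    using ne by (simp add: rev_nth last_conv_nth)
  also have "\<dots> = Max (set xs)"
  proof (rule Max_eqI[symmetric])
    show "y \<le> last xs" if "y \<in> set xs" for y
      using that xs(1) ne by (auto simp: in_set_conv_nth last_conv_nth intro!: sorted_nth_mono)
  qed (use ne in auto)
  finally show ?thesis using xs by simp
qed

lemma eigval_1_attained:
  fixes A :: "real^'d^'d"
  assumes e: "eigbasis A u a"
  obtains i where "eigval 1 A = a i"
proof -
  have "Max (range a) \<in> range a" by (rule Max_in) auto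
  then show ?thesis using that eigbasis_eigval_1[OF e] by (metis rangeE)
qed

text \<open>Rayleigh's principle, phrased as the semidefinite bound of \<open>A\<close> by
  \<open>c\<close> times the identity. Comparisons of top eigenvalues pass through quadratic forms
  by this equivalence.\<close>

lemma eigval_1_le_iff:
  assumes "symmetric_mat A"
  shows "eigval 1 A \<le> c \<longleftrightarrow> (\<forall>x. x \<bullet> (A *v x) \<le> c * (x \<bullet> x))"
proof -
  obtain u a where e: "eigbasis A u a" using assms by (rule symmetric_mat_eigbasis)
  have "eigval 1 A \<le> c \<longleftrightarrow> (\<forall>i. a i \<le> c)" by (simp add: eigbasis_eigval_1[OF e, simplified])
  also have "\<dots> \<longleftrightarrow> (\<forall>x. x \<bullet> (A *v x) \<le> c * (x \<bullet> x))"
  proof safe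
    fix x assume "\<forall>i. a i \<le> c"
    then have "a i * (u i \<bullet> x) * (u i \<bullet> x) \<le> c * ((u i \<bullet> x) * (u i \<bullet> x))" for i
      by (simp add: mult.assoc mult_right_mono)
    then show "x \<bullet> (A *v x) \<le> c * (x \<bullet> x)"
      unfolding eigbasis_inner_mult_vec[OF e] eigbasis_inner[OF e, of x x] sum_distrib_left
      by (intro sum_mono)
  next
    fix i assume "\<forall>x. x \<bullet> (A *v x) \<le> c * (x \<bullet> x)"
    from this[rule_format, of "u i"] show "a i \<le> c" by (simp add: eigbasisD[OF e])
  qed
  finally show ?thesis .
qed

lemma eigval_1_ge: "symmetric_mat A \<Longrightarrow> x \<bullet> (A *v x) \<le> eigval 1 A * (x \<bullet> x)"
  using eigval_1_le_iff[of A "eigval 1 A"] by simp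

lemma symmetric_mat_combine [intro]:
  "symmetric_mat A \<Longrightarrow> symmetric_mat B \<Longrightarrow> symmetric_mat (A + B)"
  "symmetric_mat A \<Longrightarrow> symmetric_mat B \<Longrightarrow> symmetric_mat (A - B)"
  "symmetric_mat A \<Longrightarrow> symmetric_mat (c *\<^sub>R A)"
  by (auto simp: symmetric_mat_def transpose_def vec_eq_iff)

text \<open>Weyl's inequality for the top eigenvalue: Rayleigh quotients add, so
  \<open>eigval 1\<close> is subadditive.\<close>

lemma eigval_1_diff_le:
  assumes "symmetric_mat A" "symmetric_mat B"
  shows "eigval 1 A - eigval 1 B \<le> eigval 1 (A - B)"
proof -
  have "eigval 1 A \<le> eigval 1 B + eigval 1 (A - B)"
    unfolding eigval_1_le_iff[OF assms(1)]
  proof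
    fix x
    show "x \<bullet> (A *v x) \<le> (eigval 1 B + eigval 1 (A - B)) * (x \<bullet> x)"
      using eigval_1_ge[OF assms(2), of x] eigval_1_ge[OF symmetric_mat_combine(2)[OF assms], of x]
      by (simp add: matrix_vector_mult_diff_rdistrib inner_diff algebra_simps)
  qed
  then show ?thesis by simp
qed

text \<open>The two hypotheses bound every eigenvalue from above and from below, and Parseval in the
  eigenbasis converts this into an operator norm bound. It reduces the norm deviation to the two
  one-sided ones.\<close>

lemma spectral_norm_le_eigval_1:
  assumes s: "symmetric_mat A" and m: "eigval 1 A \<le> m" "eigval 1 (- A) \<le> m"
  shows "spectral_norm A \<le> m"
proof -
  obtain u a where e: "eigbasis A u a" using s by (rule symmetric_mat_eigbasis)
  have s': "symmetric_mat (- A)" using symmetric_mat_combine(3)[OF s, of "-1"] by simp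
  have a: "\<bar>a i\<bar> \<le> m" for i
  proof -
    have "u i \<bullet> (A *v u i) \<le> m * (u i \<bullet> u i)" "u i \<bullet> (- A *v u i) \<le> m * (u i \<bullet> u i)"
      using m eigval_1_le_iff[OF s] eigval_1_le_iff[OF s'] by blast+
    then have "a i \<le> m" "- a i \<le> m"
      by (simp_all add: eigbasisD[OF e] minus_matrix_mult_vec)
    then show ?thesis by linarith
  qed
  \<comment> \<open>Any index will do: the type \<open>'d\<close> is inhabited, so
    \<open>undefined\<close> names one of its elements.\<close>
  have m0: "0 \<le> m" using a[of undefined] by linarith
  have "norm (A *v x) \<le> m * norm x" for x
  proof (rule power2_le_imp_le)
    have "(norm (A *v x))\<^sup>2 = (\<Sum>i\<in>UNIV. (a i)\<^sup>2 * (u i \<bullet> x)\<^sup>2)"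
      unfolding power2_norm_eq_inner
      by (subst eigbasis_inner[OF e]) (simp add: eigbasis_mult_vec[OF e] power2_eq_square mult_ac)
    also have "\<dots> \<le> (\<Sum>i\<in>UNIV. m\<^sup>2 * (u i \<bullet> x)\<^sup>2)"
      by (intro sum_mono mult_right_mono abs_le_square_iff[THEN iffD1]) (use a m0 in auto)
    also have "\<dots> = (m * norm x)\<^sup>2"
      unfolding power_mult_distrib power2_norm_eq_inner
      by (subst eigbasis_inner[OF e]) (simp add: sum_distrib_left power2_eq_square mult_ac)
    finally show "(norm (A *v x))\<^sup>2 \<le> (m * norm x)\<^sup>2" .
  qed (use m0 in simp)
  then show ?thesis unfolding spectral_norm_def by (rule onorm_le)
qed

lemma spectral_norm_psd:
  assumes s: "symmetric_mat A" and p: "pos_semidef A"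
  shows "spectral_norm A = eigval 1 A"
proof (rule antisym)
  obtain u a where e: "eigbasis A u a" using s by (rule symmetric_mat_eigbasis)
  have a0: "0 \<le> a i" for i
    using p[unfolded pos_semidef_def, rule_format, of "u i"] by (simp add: eigbasisD[OF e])
  obtain i where i: "eigval 1 A = a i" using eigval_1_attained[OF e] .
  have "norm (A *v u i) \<le> spectral_norm A * norm (u i)"
    unfolding spectral_norm_def by (rule onorm) (rule matrix_vector_mul_bounded_linear)
  then show "eigval 1 A \<le> spectral_norm A" unfolding i using a0[of i] by (simp add: eigbasisD[OF e])
  have s': "symmetric_mat (- A)" using symmetric_mat_combine(3)[OF s, of "-1"] by simp
  have "eigval 1 (- A) \<le> 0" unfolding eigval_1_le_iff[OF s']
    using p by (simp add: minus_matrix_mult_vec pos_semidef_def)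
  then show "spectral_norm A \<le> eigval 1 A"
    using a0[of i] i by (intro spectral_norm_le_eigval_1[OF s]) auto
qed

lemma eigval_1_pos:
  assumes s: "symmetric_mat A" and p: "pos_semidef A" and "A \<noteq> 0"
  shows "0 < eigval 1 A"
proof (rule ccontr)
  assume "\<not> 0 < eigval 1 A"
  then have "spectral_norm A \<le> 0" using spectral_norm_psd[OF s p] by simp
  moreover have "norm (A *v x) \<le> spectral_norm A * norm x" for x
    unfolding spectral_norm_def by (rule onorm) (rule matrix_vector_mul_bounded_linear)
  ultimately have "A *v x = 0" for x
    by (metis mult_nonpos_nonneg norm_ge_zero norm_le_zero_iff order_trans)
  then show False using \<open>A \<noteq> 0\<close> by (metis matrix_eq matrix_vector_mult_0)
qed

text \<open>The trace is the sum of the nonnegative eigenvalues. For the effective rank this reads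
  \<open>r \<ge> 1\<close>.\<close>

lemma eigval_1_le_trace:
  assumes s: "symmetric_mat A" and p: "pos_semidef A"
  shows "eigval 1 A \<le> trace A"
proof -
  obtain u a where e: "eigbasis A u a" using s by (rule symmetric_mat_eigbasis)
  have a0: "0 \<le> a i" for i
    using p[unfolded pos_semidef_def, rule_format, of "u i"] by (simp add: eigbasisD[OF e])
  have "trace A = (\<Sum>i\<in>UNIV. a i)" by (simp add: eigbasis_trace[OF e] eigbasisD[OF e])
  moreover obtain i where "eigval 1 A = a i" using eigval_1_attained[OF e] .
  ultimately show ?thesis using member_le_sum[of i UNIV a] a0 by simp
qed

text \<open>This gives meaning to the choice of \<open>A\<close> in \<open>mv_normal\<close>. The
  witness has columns \<open>sqrt (a j) *\<^sub>R u j\<close>; it need not be symmetric, as the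
  requirement is only \<open>A ** transpose A = C\<close>.\<close>

lemma psd_sqrt_exists:
  fixes C :: "real^'d^'d"
  assumes s: "symmetric_mat C" and p: "pos_semidef C"
  shows "\<exists>A :: real^'d^'d. A ** transpose A = C"
proof -
  obtain u a where e: "eigbasis C u a" using s by (rule symmetric_mat_eigbasis)
  have a0: "0 \<le> a i" for i
    using p[unfolded pos_semidef_def, rule_format, of "u i"] by (simp add: eigbasisD[OF e])
  define A :: "real^'d^'d" where "A = (\<chi> i j. sqrt (a j) * u j $ i)"
  have "(A ** transpose A) $ i $ k = C $ i $ k" for i k
  proof -
    have "(A ** transpose A) $ i $ k = (\<Sum>j\<in>UNIV. a j * (u j $ i) * (u j $ k))"
      unfolding A_def matrix_matrix_mult_def transpose_def using a0
      by (auto intro!: sum.cong)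
    also have "\<dots> = axis i 1 \<bullet> (C *v axis k 1)"
      by (subst eigbasis_inner_mult_vec[OF e]) (simp add: inner_axis)
    also have "\<dots> = C $ i $ k" by (simp add: inner_axis' matrix_vector_mult_basis column_def)
    finally show ?thesis .
  qed
  then show ?thesis by (auto simp: vec_eq_iff)
qed

section \<open>The matrix exponential and the Golden-Thompson inequality\<close>

primrec mpow :: "real^'d^'d \<Rightarrow> nat \<Rightarrow> real^'d^'d" where
  "mpow A 0 = mat 1"
| "mpow A (Suc n) = A ** mpow A n"

lemma mpow_add: "mpow A (m + n) = mpow A m ** mpow A n"
  by (induction m) (simp_all add: matrix_mul_assoc)

lemma mpow_double: "mpow A (2 * n) = mpow (A ** A) n"
  by (induction n) (simp_all add: matrix_mul_assoc)

lemma mpow_Suc_right: "mpow A (Suc n) = mpow A n ** A"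
  using mpow_add[of A n 1] by simp

lemma transpose_mpow: "transpose (mpow A n) = mpow (transpose A) n"
proof (induction n)
  case (Suc n)
  have "transpose (mpow A (Suc n)) = mpow (transpose A) n ** transpose A"
    using Suc by (simp add: matrix_transpose_mul)
  then show ?case using mpow_Suc_right by metis
qed (simp add: transpose_mat)

lemma mpow_mult_swap: "mpow (A ** B) n ** A = A ** mpow (B ** A) n" for A B :: "real^'d^'d"
  by (induction n) (simp_all add: matrix_mul_assoc[symmetric])

text \<open>One factor can be split off at each end,
  \<open>mpow (A ** B) (Suc m) = A ** mpow (B ** A) m ** B\<close>, and cyclicity of the trace moves
  the last factor to the front.\<close>

lemma trace_mpow_mult_commute: "trace (mpow (A ** B) n) = trace (mpow (B ** A) n)" for A B :: "real^'d^'d"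
proof (cases n)
  case (Suc m)
  have "mpow (A ** B) n = (A ** mpow (B ** A) m) ** B"
    by (metis Suc mpow_Suc_right matrix_mul_assoc mpow_mult_swap)
  then have "trace (mpow (A ** B) n) = trace (B ** (A ** mpow (B ** A) m))"
    by (metis trace_mul_sym)
  then show ?thesis by (simp add: Suc matrix_mul_assoc)
qed simp

text \<open>The Euclidean inner product on matrices is the Hilbert-Schmidt one, so Cauchy-Schwarz
  becomes a trace inequality.\<close>

lemma inner_eq_trace: "X \<bullet> Y = trace (transpose X ** Y)" for X Y :: "real^'d^'d"
  unfolding inner_vec_def trace_def matrix_matrix_mult_def transpose_def inner_real_def
  by (subst sum.swap) simp

lemma trace_mult_le_norm: "\<bar>trace (X ** Y)\<bar> \<le> norm (transpose X) * norm Y" for X Y :: "real^'d^'d"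
  using Cauchy_Schwarz_ineq2[of "transpose X" Y] by (simp add: inner_eq_trace)

lemma norm_transpose: "norm (transpose X) = norm X" for X :: "real^'d^'d"
  unfolding norm_eq_sqrt_inner inner_eq_trace by (subst trace_mul_sym) simp

text \<open>The two claims feed each other. At the next level the first one uses itself for
  \<open>M ** M\<close> and the second for the symmetric pair \<open>transpose M ** M\<close>,
  \<open>M ** transpose M\<close>; the second uses the first for \<open>X ** Y\<close> and itself
  for the squares. Exponents that are powers of two suffice, since \<open>mexp\<close> is a limit
  along them.\<close>

lemma trace_power_inequalities:
  fixes M X Y :: "real^'d^'d"
  shows "\<bar>trace (mpow M (2 ^ Suc k))\<bar> \<le> trace (mpow (transpose M ** M) (2 ^ k))"
    and "symmetric_mat X \<Longrightarrow> symmetric_mat Y \<Longrightarrow>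
      trace (mpow (X ** Y) (2 ^ k)) \<le> trace (mpow X (2 ^ k) ** mpow Y (2 ^ k))"
proof (induction k arbitrary: M X Y)
  case 0
  { case 1
    have "norm M * norm M = trace (transpose M ** M)"
      by (metis inner_eq_trace power2_eq_square power2_norm_eq_inner)
    then show ?case using trace_mult_le_norm[of M M]
      by (simp add: norm_transpose numeral_2_eq_2)
  next
    case 2
    show ?case by simp
  }
next
  case (Suc k)
  { case 1
    let ?T = "transpose M"
    let ?A = "mpow (?T ** M) (2 ^ k)" and ?B = "mpow (M ** ?T) (2 ^ k)"
    have sym: "symmetric_mat (?T ** M)" "symmetric_mat (M ** ?T)"
      by (simp_all add: symmetric_mat_def matrix_transpose_mul)
    have "\<bar>trace (mpow M (2 ^ Suc (Suc k)))\<bar> = \<bar>trace (mpow (M ** M) (2 ^ Suc k))\<bar>"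
      by (simp only: power_Suc mpow_double)
    also have "\<dots> \<le> trace (mpow (transpose (M ** M) ** (M ** M)) (2 ^ k))" by (rule Suc.IH(1))
    also have "transpose (M ** M) ** (M ** M) = ?T ** ((?T ** M) ** M)"
      by (simp add: matrix_transpose_mul matrix_mul_assoc)
    \<comment> \<open>Moving the leading \<open>?T\<close> to the back by cyclicity exhibits a
      product of two symmetric matrices, to which the second inequality at level \<open>k\<close>
      applies.\<close>
    also have "trace (mpow \<dots> (2 ^ k)) = trace (mpow ((?T ** M) ** (M ** ?T)) (2 ^ k))"
      by (subst trace_mpow_mult_commute) (simp add: matrix_mul_assoc)
    also have "\<dots> \<le> trace (?A ** ?B)" by (rule Suc.IH(2)[OF sym])
    also have "\<dots> \<le> norm ?A * norm ?B"
      using trace_mult_le_norm[of ?A ?B] by (simp add: norm_transpose)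
    \<comment> \<open>The Hilbert-Schmidt norm of a power of a symmetric matrix is the root of the
      trace of its square, and these traces agree for the two matrices by cyclicity.\<close>
    also have "norm ?B = norm ?A"
    proof -
      have "norm (mpow S n) = sqrt (trace (mpow S (n + n)))" if "symmetric_mat S" for S :: "real^'d^'d" and n
        using that unfolding norm_eq_sqrt_inner inner_eq_trace transpose_mpow
        by (simp add: symmetric_mat_def mpow_add)
      then show ?thesis using sym by (simp add: trace_mpow_mult_commute)
    qed
    also have "norm ?A * norm ?A = trace (mpow (?T ** M) (2 ^ Suc k))"
    proof -
      have "norm ?A * norm ?A = ?A \<bullet> ?A" by (metis power2_eq_square power2_norm_eq_inner)
      also have "\<dots> = trace (?A ** ?A)"
        unfolding inner_eq_trace transpose_mpow using sym by (simp add: symmetric_mat_def)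
      finally show ?thesis by (simp add: mpow_add[symmetric] mult_2)
    qed
    finally show ?case .
  next
    case (2 X Y)
    then have t: "transpose X = X" "transpose Y = Y" by (auto simp: symmetric_mat_def)
    have sym: "symmetric_mat (X ** X)" "symmetric_mat (Y ** Y)"
      by (simp_all add: symmetric_mat_def matrix_transpose_mul t)
    have "trace (mpow (X ** Y) (2 ^ Suc k)) \<le> trace (mpow (transpose (X ** Y) ** (X ** Y)) (2 ^ k))"
      using Suc.IH(1)[of "X ** Y"] by linarith
    also have "transpose (X ** Y) ** (X ** Y) = Y ** ((X ** X) ** Y)"
      by (simp add: matrix_transpose_mul matrix_mul_assoc t)
    also have "trace (mpow \<dots> (2 ^ k)) = trace (mpow ((X ** X) ** (Y ** Y)) (2 ^ k))"
      by (subst trace_mpow_mult_commute) (simp add: matrix_mul_assoc)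
    also have "\<dots> \<le> trace (mpow (X ** X) (2 ^ k) ** mpow (Y ** Y) (2 ^ k))"
      by (rule Suc.IH(2)[OF sym])
    finally show ?case by (simp only: power_Suc mpow_double)
  }
qed

section \<open>The matrix exponential as a dyadic limit\<close>

lemma tendsto_matrix_mult:
  fixes f g :: "'b \<Rightarrow> real^'d^'d"
  assumes "(f \<longlongrightarrow> A) F" "(g \<longlongrightarrow> B) F"
  shows "((\<lambda>x. f x ** g x) \<longlongrightarrow> A ** B) F"
  unfolding matrix_matrix_mult_def
  by (intro vec_tendstoI) (auto intro!: tendsto_intros assms)

lemma tendsto_trace:
  fixes f :: "'b \<Rightarrow> real^'d^'d"
  shows "(f \<longlongrightarrow> A) F \<Longrightarrow> ((\<lambda>x. trace (f x)) \<longlongrightarrow> trace A) F"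
  unfolding trace_def by (intro tendsto_intros)

text \<open>Euler's limit along exponents \<open>2 ^ k\<close> matches the trace inequality
  available for such exponents, and presents the exponential as a limit of polynomial maps.\<close>

definition mexp :: "real^'d^'d \<Rightarrow> real^'d^'d" where
  "mexp A = lim (\<lambda>k. mpow (mat 1 + (1 / 2 ^ k) *\<^sub>R A) (2 ^ k))"

lemma eigbasis_component:
  fixes A :: "real^'d^'d"
  assumes e: "eigbasis A u a"
  shows "A $ j $ k = (\<Sum>i\<in>UNIV. a i * u i $ j * u i $ k)"
proof -
  have "A $ j $ k = axis j 1 \<bullet> (A *v axis k 1)"
    by (simp add: inner_axis' matrix_vector_mult_basis column_def)
  then show ?thesis by (simp add: eigbasis_inner_mult_vec[OF e] inner_axis)
qed

lemma eigbasis_mpow: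
  assumes e: "eigbasis A u a"
  shows "eigbasis (mpow A n) u (\<lambda>i. a i ^ n)"
proof -
  have "mpow A n *v u i = (a i ^ n) *\<^sub>R u i" for i
    by (induction n) (simp_all add: matrix_vector_mul_assoc[symmetric] eigbasisD(2)[OF e]
        linear_scale[OF matrix_vector_mul_linear])
  then show ?thesis using e by (simp add: eigbasis_def)
qed

lemma matrix_scaleR_mult_vec: "(c *\<^sub>R A) *v x = c *\<^sub>R (A *v x)" for A :: "real^'d^'d"
  by (simp add: vec_eq_iff matrix_vector_mult_def sum_distrib_left mult.assoc)

lemma eigbasis_affine:
  assumes e: "eigbasis A u a"
  shows "eigbasis (mat 1 + c *\<^sub>R A) u (\<lambda>i. 1 + c * a i)"
  using e by (simp add: eigbasis_def matrix_vector_mult_add_rdistrib matrix_scaleR_mult_vec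
      scaleR_left_distrib)

lemma eigbasis_synthesis:
  assumes e: "eigbasis A u a"
  shows "eigbasis (\<chi> j k. \<Sum>i\<in>UNIV. b i * u i $ j * u i $ k) u b"
proof -
  have "(\<chi> j k. \<Sum>i\<in>UNIV. b i * u i $ j * u i $ k) *v u l = b l *\<^sub>R u l" for l
  proof -
    have "((\<chi> j k. \<Sum>i\<in>UNIV. b i * u i $ j * u i $ k) *v u l) $ j = b l * u l $ j" for j
    proof -
      have "((\<chi> j k. \<Sum>i\<in>UNIV. b i * u i $ j * u i $ k) *v u l) $ j
        = (\<Sum>k\<in>UNIV. \<Sum>i\<in>UNIV. b i * u i $ j * (u i $ k * u l $ k))"
        by (simp add: matrix_vector_mult_def sum_distrib_right mult.assoc)
      also have "\<dots> = (\<Sum>i\<in>UNIV. b i * u i $ j * (u i \<bullet> u l))"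
        by (subst sum.swap) (simp add: inner_vec_def sum_distrib_left)
      also have "\<dots> = (\<Sum>i\<in>UNIV. if i = l then b i * u i $ j else 0)"
        by (intro sum.cong refl) (simp add: eigbasisD(1)[OF e])
      finally show ?thesis by simp
    qed
    then show ?thesis by (simp add: vec_eq_iff)
  qed
  then show ?thesis using e by (simp add: eigbasis_def)
qed

text \<open>All approximants share the eigenbasis \<open>u\<close>, so the limit is taken entry by
  entry and reduces to Euler's limit for each scalar \<open>a i\<close>. The limit matrix is
  synthesised beforehand from the eigenvalues \<open>exp (a i)\<close>.\<close>

lemma
  assumes e: "eigbasis A u a"
  shows eigbasis_mexp: "eigbasis (mexp A) u (\<lambda>i. exp (a i))"
    and eigbasis_mexp_tendsto: "(\<lambda>k. mpow (mat 1 + (1 / 2 ^ k) *\<^sub>R A) (2 ^ k)) \<longlonglongrightarrow> mexp A"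
proof -
  define E where "E = (\<chi> j k. \<Sum>i\<in>UNIV. exp (a i) * u i $ j * u i $ k)"
  have E: "eigbasis E u (\<lambda>i. exp (a i))" unfolding E_def by (rule eigbasis_synthesis[OF e])
  have ex: "(\<lambda>k. (1 + 1 / 2 ^ k * x) ^ (2 ^ k)) \<longlonglongrightarrow> exp x" for x :: real
  proof -
    have "filterlim (\<lambda>k::nat. (2::nat) ^ k) sequentially sequentially"
      by (rule filterlim_subseq) (simp add: strict_mono_def)
    from filterlim_compose[OF tendsto_exp_limit_sequentially this, of x] show ?thesis by simp
  qed
  have L: "(\<lambda>k. mpow (mat 1 + (1 / 2 ^ k) *\<^sub>R A) (2 ^ k)) \<longlonglongrightarrow> E"
  proof (intro vec_tendstoI)
    fix i j
    show "(\<lambda>k. mpow (mat 1 + (1 / 2 ^ k) *\<^sub>R A) (2 ^ k) $ i $ j) \<longlonglongrightarrow> E $ i $ j"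
      unfolding eigbasis_component[OF E] eigbasis_component[OF eigbasis_mpow[OF eigbasis_affine[OF e]]]
      by (intro tendsto_intros ex)
  qed
  have "mexp A = E" unfolding mexp_def by (rule limI[OF L])
  then show "eigbasis (mexp A) u (\<lambda>i. exp (a i))"
    and "(\<lambda>k. mpow (mat 1 + (1 / 2 ^ k) *\<^sub>R A) (2 ^ k)) \<longlonglongrightarrow> mexp A"
    using E L by simp_all
qed

lemma mexp_tendsto:
  assumes "symmetric_mat A"
  shows "(\<lambda>k. mpow (mat 1 + (1 / 2 ^ k) *\<^sub>R A) (2 ^ k)) \<longlonglongrightarrow> mexp A"
proof -
  obtain u a where "eigbasis A u a" using assms by (rule symmetric_mat_eigbasis)
  then show ?thesis by (rule eigbasis_mexp_tendsto)
qed

section \<open>Product formula and the Golden-Thompson inequality\<close>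

lemma matrix_diff_ldistrib: "A ** (B - C) = A ** B - A ** C" for A B C :: "real^'d^'d"
  by (simp add: matrix_matrix_mult_def vec_eq_iff right_diff_distrib sum_subtractf)

lemma matrix_diff_rdistrib: "(B - C) ** A = B ** A - C ** A" for A B C :: "real^'d^'d"
  by (simp add: matrix_matrix_mult_def vec_eq_iff left_diff_distrib sum_subtractf)

lemma symmetric_mat_1: "symmetric_mat (mat 1)"
  by (simp add: symmetric_mat_def transpose_mat)

lemma norm_mpow_le:
  fixes Y :: "real^'d^'d"
  assumes "\<And>v. norm (Y *v v) \<le> m * norm v" "0 \<le> m"
  shows "norm (mpow Y n *v v) \<le> m ^ n * norm v"
proof (induction n)
  case (Suc n)
  have "norm (mpow Y (Suc n) *v v) \<le> m * norm (mpow Y n *v v)"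
    using assms(1) by (simp add: matrix_vector_mul_assoc[symmetric])
  also have "\<dots> \<le> m * (m ^ n * norm v)" using Suc assms(2) by (rule mult_left_mono)
  finally show ?case by (simp add: mult.assoc)
qed simp

text \<open>Telescoping: replacing one factor \<open>X\<close> by \<open>Y\<close> costs
  \<open>\<delta>\<close> times the bounds of the other factors. The hypothesis
  \<open>1 \<le> m\<close> allows the exponent \<open>n\<close> in place of
  \<open>n - 1\<close>.\<close>

lemma norm_mpow_diff_le:
  fixes X Y :: "real^'d^'d"
  assumes X: "\<And>v. norm (X *v v) \<le> m * norm v" and Y: "\<And>v. norm (Y *v v) \<le> m * norm v"
    and D: "\<And>v. norm ((X - Y) *v v) \<le> \<delta> * norm v" and m: "1 \<le> m" and \<delta>: "0 \<le> \<delta>"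
  shows "norm ((mpow X n - mpow Y n) *v v) \<le> real n * m ^ n * \<delta> * norm v"
proof (induction n)
  case (Suc n)
  have "mpow X (Suc n) - mpow Y (Suc n) = X ** (mpow X n - mpow Y n) + (X - Y) ** mpow Y n"
    by (simp add: matrix_diff_ldistrib matrix_diff_rdistrib)
  then have "norm ((mpow X (Suc n) - mpow Y (Suc n)) *v v)
      \<le> norm (X *v ((mpow X n - mpow Y n) *v v)) + norm ((X - Y) *v (mpow Y n *v v))"
    by (simp add: matrix_vector_mul_assoc matrix_vector_mult_add_rdistrib norm_triangle_ineq)
  also have "\<dots> \<le> m * (real n * m ^ n * \<delta> * norm v) + \<delta> * (m ^ n * norm v)"
  proof (rule add_mono)
    show "norm (X *v ((mpow X n - mpow Y n) *v v)) \<le> m * (real n * m ^ n * \<delta> * norm v)"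
      using X mult_left_mono[OF Suc, of m] m by (meson order_trans zero_le_one)
    have "norm (mpow Y n *v v) \<le> m ^ n * norm v" using Y m by (intro norm_mpow_le) auto
    then show "norm ((X - Y) *v (mpow Y n *v v)) \<le> \<delta> * (m ^ n * norm v)"
      using D \<delta> by (meson mult_left_mono order_trans)
  qed
  also have "\<dots> \<le> m * (real n * m ^ n * \<delta> * norm v) + \<delta> * (m ^ Suc n * norm v)"
    using m \<delta> by (intro add_left_mono mult_left_mono mult_right_mono power_increasing) auto
  also have "\<dots> = real (Suc n) * m ^ Suc n * \<delta> * norm v" by (simp add: algebra_simps)
  finally show ?case .
qed simp

lemma abs_trace_le:
  fixes D :: "real^'d^'d"
  assumes "\<And>v. norm (D *v v) \<le> \<epsilon> * norm v"
  shows "\<bar>trace D\<bar> \<le> real CARD('d) * \<epsilon>"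
proof -
  have "\<bar>D $ i $ i\<bar> \<le> \<epsilon>" for i
  proof -
    have "\<bar>D $ i $ i\<bar> = \<bar>(D *v axis i 1) $ i\<bar>" by (simp add: matrix_vector_mult_basis column_def)
    also have "\<dots> \<le> norm (D *v axis i 1)" by (rule component_le_norm_cart)
    also have "\<dots> \<le> \<epsilon>" using assms[of "axis i 1"] by simp
    finally show ?thesis .
  qed
  then have "\<bar>trace D\<bar> \<le> (\<Sum>i\<in>(UNIV::'d set). \<epsilon>)"
    unfolding trace_def by (intro order_trans[OF sum_abs] sum_mono)
  then show ?thesis by simp
qed

text \<open>The dyadic approximants \<open>P k\<close> and \<open>Q k\<close> of the two
  exponentials satisfy the trace inequality at every level. Their product differs from the
  approximant \<open>R k\<close> of the sum to second order only, so the powers of order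
  \<open>2 ^ k\<close> have the same limiting trace.\<close>

theorem golden_thompson:
  fixes A B :: "real^'d^'d"
  assumes A: "symmetric_mat A" and B: "symmetric_mat B"
  shows "trace (mexp (A + B)) \<le> trace (mexp A ** mexp B)"
proof -
  define P where "P k = mat 1 + (1 / 2 ^ k) *\<^sub>R A" for k :: nat
  define Q where "Q k = mat 1 + (1 / 2 ^ k) *\<^sub>R B" for k :: nat
  define R where "R k = mat 1 + (1 / 2 ^ k) *\<^sub>R (A + B)" for k :: nat
  define \<alpha> \<beta> where "\<alpha> = onorm ((*v) A)" and "\<beta> = onorm ((*v) B)"
  have on: "norm (A *v v) \<le> \<alpha> * norm v" "norm (B *v v) \<le> \<beta> * norm v" for v
    unfolding \<alpha>_def \<beta>_def by (auto intro!: onorm matrix_vector_mul_bounded_linear)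
  have nn: "0 \<le> \<alpha>" "0 \<le> \<beta>"
    unfolding \<alpha>_def \<beta>_def by (auto intro!: onorm_pos_le matrix_vector_mul_bounded_linear)
  have sym: "symmetric_mat (P k)" "symmetric_mat (Q k)" for k
    unfolding P_def Q_def by (intro symmetric_mat_combine symmetric_mat_1 A B)+
  have close: "\<bar>trace (mpow (P k ** Q k) (2 ^ k) - mpow (R k) (2 ^ k))\<bar>
      \<le> real CARD('d) * (exp (\<alpha> + \<beta>) * \<alpha> * \<beta> * (1 / 2 ^ k))" for k
  proof (rule abs_trace_le)
    fix v
    let ?c = "1 / 2 ^ k :: real" and ?N = "2 ^ k :: nat"
    define m where "m = (1 + ?c * \<alpha>) * (1 + ?c * \<beta>)"
    have affine: "norm ((mat 1 + ?c *\<^sub>R X) *v v) \<le> (1 + ?c * \<gamma>) * norm v"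
      if "\<And>v. norm (X *v v) \<le> \<gamma> * norm v" for X :: "real^'d^'d" and \<gamma> v
    proof -
      have "norm ((mat 1 + ?c *\<^sub>R X) *v v) \<le> norm v + ?c * norm (X *v v)"
        using norm_triangle_ineq[of v "?c *\<^sub>R (X *v v)"]
        by (simp add: matrix_vector_mult_add_rdistrib matrix_scaleR_mult_vec)
      also have "\<dots> \<le> norm v + ?c * (\<gamma> * norm v)" by (intro add_left_mono mult_left_mono that) auto
      finally show ?thesis by (simp add: algebra_simps)
    qed
    have "1 \<le> m" unfolding m_def using nn by (simp add: algebra_simps)
    have X: "norm ((P k ** Q k) *v v) \<le> m * norm v" for v
    proof -
      have "norm ((P k ** Q k) *v v) \<le> (1 + ?c * \<alpha>) * norm (Q k *v v)"
        using affine[OF on(1)] by (simp add: P_def matrix_vector_mul_assoc[symmetric])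
      also have "\<dots> \<le> (1 + ?c * \<alpha>) * ((1 + ?c * \<beta>) * norm v)"
        unfolding Q_def using nn by (intro mult_left_mono affine[OF on(2)]) auto
      finally show ?thesis by (simp add: m_def mult.assoc)
    qed
    have Y: "norm (R k *v v) \<le> m * norm v" for v
    proof -
      have "norm ((A + B) *v v) \<le> (\<alpha> + \<beta>) * norm v" for v
        using on[of v] norm_triangle_ineq[of "A *v v" "B *v v"]
        by (simp add: matrix_vector_mult_add_rdistrib algebra_simps)
      from affine[OF this] have "norm (R k *v v) \<le> (1 + ?c * (\<alpha> + \<beta>)) * norm v" by (simp add: R_def)
      also have "\<dots> \<le> m * norm v" unfolding m_def using nn
        by (intro mult_right_mono) (auto simp: algebra_simps add_divide_distrib)
      finally show ?thesis .
    qed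
    \<comment> \<open>The difference is exactly the cross term
      \<open>?c\<^sup>2 *\<^sub>R (A ** B)\<close> of the product of the two affine factors.\<close>
    have D: "norm ((P k ** Q k - R k) *v v) \<le> (?c\<^sup>2 * \<alpha> * \<beta>) * norm v" for v
    proof -
      have "(P k ** Q k - R k) *v v = (?c\<^sup>2) *\<^sub>R (A *v (B *v v))"
        by (simp add: P_def Q_def R_def matrix_vector_mult_diff_rdistrib matrix_vector_mult_add_rdistrib
            matrix_scaleR_mult_vec matrix_vector_mul_assoc[symmetric] matrix_vector_right_distrib
            linear_scale[OF matrix_vector_mul_linear] scaleR_right_distrib power2_eq_square)
      then have "norm ((P k ** Q k - R k) *v v) = ?c\<^sup>2 * norm (A *v (B *v v))" by simp
      also have "\<dots> \<le> ?c\<^sup>2 * (\<alpha> * (\<beta> * norm v))"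
        using nn by (intro mult_left_mono order_trans[OF on(1)] on(2)) auto
      finally show ?thesis by (simp add: mult.assoc)
    qed
    \<comment> \<open>The growth factor is bounded uniformly in \<open>k\<close>, so telescoping
      over \<open>?N\<close> factors with error of order \<open>1 / ?N\<^sup>2\<close> each leaves a
      total of order \<open>1 / ?N\<close>.\<close>
    have "m ^ ?N \<le> exp (\<alpha> + \<beta>)"
    proof -
      have *: "(1 + ?c * \<gamma>) ^ ?N \<le> exp \<gamma>" if "0 \<le> \<gamma>" for \<gamma>
        using exp_ge_one_plus_x_over_n_power_n[of ?N \<gamma>] order_trans[OF _ that, of "- (2 ^ k)"]
        by simp
      show ?thesis unfolding m_def power_mult_distrib exp_add using nn by (intro mult_mono * ) auto
    qed
    then have "m ^ ?N * (?c * \<alpha> * \<beta>) \<le> exp (\<alpha> + \<beta>) * (?c * \<alpha> * \<beta>)"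
      using nn by (intro mult_right_mono) auto
    then have "real ?N * m ^ ?N * (?c\<^sup>2 * \<alpha> * \<beta>) \<le> exp (\<alpha> + \<beta>) * \<alpha> * \<beta> * ?c"
      by (simp add: power2_eq_square mult_ac)
    moreover have "norm ((mpow (P k ** Q k) ?N - mpow (R k) ?N) *v v)
        \<le> real ?N * m ^ ?N * (?c\<^sup>2 * \<alpha> * \<beta>) * norm v"
      using X Y D \<open>1 \<le> m\<close> nn by (intro norm_mpow_diff_le) auto
    ultimately show "norm ((mpow (P k ** Q k) ?N - mpow (R k) ?N) *v v)
        \<le> exp (\<alpha> + \<beta>) * \<alpha> * \<beta> * ?c * norm v"
      by (meson mult_right_mono norm_ge_zero order_trans)
  qed
  have c0: "(\<lambda>k. real CARD('d) * (exp (\<alpha> + \<beta>) * \<alpha> * \<beta> * (1 / 2 ^ k))) \<longlonglongrightarrow> 0"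
    using LIMSEQ_realpow_zero[of "1/2"] by (intro tendsto_mult_right_zero) (simp add: power_one_over)
  have d: "(\<lambda>k. trace (mpow (P k ** Q k) (2 ^ k) - mpow (R k) (2 ^ k))) \<longlonglongrightarrow> 0"
    by (rule Lim_null_comparison[OF _ c0]) (use close in auto)
  have e: "(\<lambda>k. trace (mpow (R k) (2 ^ k))) \<longlonglongrightarrow> trace (mexp (A + B))"
    unfolding R_def by (intro tendsto_trace mexp_tendsto symmetric_mat_combine A B)
  have "(\<lambda>k. trace (mpow (P k ** Q k) (2 ^ k))) \<longlonglongrightarrow> trace (mexp (A + B))"
    using tendsto_add[OF d e] by (simp add: trace_sub)
  moreover have "(\<lambda>k. trace (mpow (P k) (2 ^ k) ** mpow (Q k) (2 ^ k))) \<longlonglongrightarrow> trace (mexp A ** mexp B)"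
    unfolding P_def Q_def by (intro tendsto_trace tendsto_matrix_mult mexp_tendsto A B)
  ultimately show ?thesis
    by (rule LIMSEQ_le) (use trace_power_inequalities(2)[OF sym] in blast)
qed

section \<open>Measurability of the exponential and the trace\<close>

lemma measurable_matrix_mult:
  fixes f g :: "'b \<Rightarrow> real^'d^'d"
  assumes "f \<in> borel_measurable M" "g \<in> borel_measurable M"
  shows "(\<lambda>x. f x ** g x) \<in> borel_measurable M"
proof -
  have "continuous_on UNIV (\<lambda>p. (fst p :: real^'d^'d) ** (snd p :: real^'d^'d))"
    unfolding continuous_on_def
    by (intro ballI tendsto_matrix_mult tendsto_fst tendsto_snd tendsto_ident_at)
  from borel_measurable_continuous_on[OF this, of "\<lambda>x. (f x, g x)" M] show ?thesis
    using assms by simp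
qed

lemma measurable_mpow:
  fixes f :: "'b \<Rightarrow> real^'d^'d"
  assumes "f \<in> borel_measurable M"
  shows "(\<lambda>x. mpow (f x) n) \<in> borel_measurable M"
  by (induction n) (auto intro!: measurable_matrix_mult assms)

text \<open>Pointwise \<open>lim\<close> of measurable maps is measurable irrespective of
  convergence, so the claim holds on all matrices although convergence is established for symmetric
  ones.\<close>

lemma measurable_mexp [measurable]: "mexp \<in> borel_measurable borel"
  unfolding mexp_def[abs_def]
  by (intro borel_measurable_lim_metric measurable_mpow) simp

lemma measurable_trace [measurable]: "trace \<in> borel_measurable (borel :: (real^'d^'d) measure)"
proof -
  have "continuous_on UNIV (trace :: real^'d^'d \<Rightarrow> real)"
    unfolding continuous_on_def by (intro ballI tendsto_trace tendsto_ident_at)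
  then show ?thesis by (rule borel_measurable_continuous_onI)
qed

section \<open>Moments of the multivariate normal distribution\<close>

lemma prob_space_std_normal: "prob_space std_normal_distribution"
  using real_dist_normal_dist by (simp add: real_distribution_def)

lemma std_normal_moment_Suc_Suc:
  "(\<integral>x. x ^ Suc (Suc k) \<partial>std_normal_distribution) = real (Suc k) * (\<integral>x. x ^ k \<partial>std_normal_distribution)"
proof -
  have i: "(\<integral>x. x ^ j \<partial>std_normal_distribution) = (\<integral>x. std_normal_density x * x ^ j \<partial>lborel)" for j
    by (subst integral_density) auto
  show ?thesis
  proof (cases "even k")
    case True
    then obtain m where k: "k = 2 * m" by (auto elim: evenE)
    have "(\<integral>x. x ^ Suc (Suc k) \<partial>std_normal_distribution) = fact (2 * Suc m) / (2 ^ Suc m * fact (Suc m))"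
      unfolding i using integral_std_normal_moment_even[of "Suc m"] by (simp add: k)
    also have "\<dots> = real (Suc k) * (fact (2 * m) / (2 ^ m * fact m))"
      by (simp add: k divide_simps)
    finally show ?thesis unfolding i using integral_std_normal_moment_even[of m] by (simp add: k)
  next
    case False
    then obtain m where k: "k = 2 * m + 1" by (auto elim: oddE)
    show ?thesis unfolding i
      using integral_std_normal_moment_odd[of m] integral_std_normal_moment_odd[of "Suc m"]
      by (simp add: k)
  qed
qed

lemma pderiv_sum: "pderiv (\<Sum>i\<in>I. p i) = (\<Sum>i\<in>I. pderiv (p i))"
  by (induction I rule: infinite_finite_induct) (simp_all add: pderiv_add)

text \<open>By linearity it suffices to treat monomials, where Stein's identity is the moment
  recursion. Polynomials are enough because the integrands below are polynomial along each
  coordinate line.\<close>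

lemma std_normal_stein_poly:
  fixes p :: "real poly"
  shows "(\<integral>x. x * poly p x \<partial>std_normal_distribution) = (\<integral>x. poly (pderiv p) x \<partial>std_normal_distribution)"
proof -
  note [simp] = integrable_std_normal_distribution_moment
  have m: "(\<integral>x. x * x ^ k \<partial>std_normal_distribution) = (\<integral>x. poly (pderiv (monom 1 k)) x \<partial>std_normal_distribution)" for k
  proof (cases k)
    case 0
    have "(\<integral>x. x \<partial>std_normal_distribution) = (\<integral>x. std_normal_density x * x \<partial>lborel)"
      by (subst integral_density) auto
    then show ?thesis using 0 integral_std_normal_moment_odd[of 0] by (simp add: monom_0 pderiv_pCons)
  next
    case (Suc j)
    then show ?thesis using std_normal_moment_Suc_Suc[of j] by (simp add: pderiv_monom poly_monom)
  qed
  have int: "integrable std_normal_distribution (\<lambda>x. poly q x)" for q :: "real poly"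
    unfolding poly_altdef by (intro Bochner_Integration.integrable_sum integrable_mult_right) simp
  have p: "p = (\<Sum>i\<le>degree p. smult (coeff p i) (monom 1 i))"
    using poly_as_sum_of_monoms[of p] by (simp add: smult_monom)
  have "(\<integral>x. x * poly p x \<partial>std_normal_distribution)
      = (\<integral>x. (\<Sum>i\<le>degree p. coeff p i * x ^ Suc i) \<partial>std_normal_distribution)"
    by (rule Bochner_Integration.integral_cong) (auto simp: poly_altdef sum_distrib_left mult_ac)
  also have "\<dots> = (\<Sum>i\<le>degree p. \<integral>x. coeff p i * x ^ Suc i \<partial>std_normal_distribution)"
    by (intro Bochner_Integration.integral_sum integrable_mult_right integrable_std_normal_distribution_moment)
  also have "\<dots> = (\<Sum>i\<le>degree p. \<integral>x. coeff p i * poly (pderiv (monom 1 i)) x \<partial>std_normal_distribution)"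
    using m by (intro sum.cong refl) simp
  also have "\<dots> = (\<integral>x. (\<Sum>i\<le>degree p. coeff p i * poly (pderiv (monom 1 i)) x) \<partial>std_normal_distribution)"
    by (intro Bochner_Integration.integral_sum[symmetric] integrable_mult_right int)
  also have "(\<lambda>x. \<Sum>i\<le>degree p. coeff p i * poly (pderiv (monom 1 i)) x) = poly (pderiv p)"
    by (rule ext, subst arg_cong[OF p, of pderiv]) (simp only: pderiv_sum pderiv_smult poly_sum poly_smult)
  finally show ?thesis .
qed

section \<open>Gaussian integration by parts in several variables\<close>

lemma measurable_vec_lambda:
  "(\<lambda>z. \<chi> i. z i) \<in> borel_measurable (\<Pi>\<^sub>M i\<in>(UNIV :: 'd::finite set). std_normal_distribution)"
proof (rule borel_measurable_euclidean_space[THEN iffD2], rule)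
  fix b :: "real^'d" assume "b \<in> Basis"
  then obtain i where b: "b = axis i 1" by (auto simp: Basis_vec_def)
  have "(\<lambda>z. z i) \<in> borel_measurable (\<Pi>\<^sub>M i\<in>(UNIV :: 'd set). std_normal_distribution)"
    using measurable_component_singleton[of i UNIV "\<lambda>_. std_normal_distribution"] by simp
  then show "(\<lambda>z. (\<chi> i. z i) \<bullet> b) \<in> borel_measurable (\<Pi>\<^sub>M i\<in>(UNIV :: 'd set). std_normal_distribution)"
    unfolding b by (simp add: inner_axis)
qed

lemma prob_space_std_mv_normal: "prob_space std_mv_normal"
  unfolding std_mv_normal_def
  by (intro prob_space.prob_space_distr prob_space_PiM prob_space_std_normal measurable_vec_lambda)

lemma sets_std_mv_normal [simp, measurable_cong]: "sets std_mv_normal = sets borel"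
  by (simp add: std_mv_normal_def)

lemma integrable_coordinate_power:
  "integrable (\<Pi>\<^sub>M i\<in>(UNIV :: 'd::finite set). std_normal_distribution) (\<lambda>z. z i ^ k)"
proof -
  have m: "(\<lambda>z. z i) \<in> measurable (\<Pi>\<^sub>M i\<in>(UNIV :: 'd set). std_normal_distribution) std_normal_distribution"
    by (rule measurable_component_singleton) simp
  have "distr (\<Pi>\<^sub>M i\<in>(UNIV :: 'd set). std_normal_distribution) std_normal_distribution (\<lambda>z. z i)
      = std_normal_distribution"
    by (rule distr_PiM_component) (simp_all add: prob_space_std_normal)
  then show ?thesis
    using integrable_distr[OF m, of "\<lambda>x. x ^ k"] integrable_std_normal_distribution_moment[of k] by simp
qed

text \<open>The norm is at most the dimension times the largest coordinate in absolute value, and an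
  even power of that coordinate is at most the sum of the even powers of all of them.\<close>

lemma integrable_std_mv_normal_norm_power:
  "integrable (std_mv_normal :: (real^'d) measure) (\<lambda>z. norm z ^ (2 * k))"
  unfolding std_mv_normal_def
proof (subst integrable_distr_eq[OF measurable_vec_lambda])
  let ?d = "real CARD('d)"
  show "integrable (\<Pi>\<^sub>M i\<in>(UNIV :: 'd set). std_normal_distribution) (\<lambda>z. norm (\<chi> i. z i) ^ (2 * k))"
  proof (rule Bochner_Integration.integrable_bound)
    show "integrable (\<Pi>\<^sub>M i\<in>(UNIV :: 'd set). std_normal_distribution)
        (\<lambda>z. ?d ^ (2 * k) * (\<Sum>i\<in>UNIV. z i ^ (2 * k)))"
      by (intro integrable_mult_right Bochner_Integration.integrable_sum integrable_coordinate_power)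
    show "(\<lambda>z. norm (\<chi> i. z i) ^ (2 * k)) \<in> borel_measurable (\<Pi>\<^sub>M i\<in>(UNIV :: 'd set). std_normal_distribution)"
      using measurable_vec_lambda by measurable
    have "norm (\<chi> i. z i) ^ (2 * k) \<le> ?d ^ (2 * k) * (\<Sum>i\<in>UNIV. z i ^ (2 * k))" for z :: "'d \<Rightarrow> real"
    proof -
      have "Max (range (\<lambda>i. \<bar>z i\<bar>)) \<in> range (\<lambda>i. \<bar>z i\<bar>)" by (rule Max_in) auto
      then obtain j where j: "Max (range (\<lambda>i. \<bar>z i\<bar>)) = \<bar>z j\<bar>" by blast
      have le: "\<bar>z i\<bar> \<le> \<bar>z j\<bar>" for i unfolding j[symmetric] by (rule Max_ge) auto
      have "norm (\<chi> i. z i) \<le> (\<Sum>i\<in>UNIV. \<bar>z i\<bar>)" using norm_le_l1_cart[of "\<chi> i. z i"] by simp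
      also have "\<dots> \<le> ?d * \<bar>z j\<bar>" using sum_bounded_above[of UNIV "\<lambda>i. \<bar>z i\<bar>" "\<bar>z j\<bar>"] le by simp
      finally have "norm (\<chi> i. z i) ^ (2 * k) \<le> (?d * \<bar>z j\<bar>) ^ (2 * k)" by (rule power_mono) simp
      also have "\<dots> = ?d ^ (2 * k) * z j ^ (2 * k)" by (simp add: power_mult_distrib power_even_abs)
      also have "z j ^ (2 * k) \<le> (\<Sum>i\<in>UNIV. z i ^ (2 * k))"
        by (rule member_le_sum) (auto simp: zero_le_even_power)
      finally show ?thesis by (simp add: mult_left_mono)
    qed
    then show "AE z in (\<Pi>\<^sub>M i\<in>(UNIV :: 'd set). std_normal_distribution).
        norm (norm (\<chi> i. z i) ^ (2 * k)) \<le> norm (?d ^ (2 * k) * (\<Sum>i\<in>UNIV. z i ^ (2 * k)))"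
      by (intro AE_I2) (auto intro: order_trans[OF _ abs_ge_self])
  qed
qed simp

lemma integrable_std_mv_normal_bound:
  fixes f :: "real^'d \<Rightarrow> real"
  assumes [measurable]: "f \<in> borel_measurable borel" and "\<And>z. \<bar>f z\<bar> \<le> K * norm z ^ (2 * k)"
  shows "integrable std_mv_normal f"
proof (rule Bochner_Integration.integrable_bound)
  show "integrable (std_mv_normal :: (real^'d) measure) (\<lambda>z. K * norm z ^ (2 * k))"
    by (intro integrable_mult_right integrable_std_mv_normal_norm_power)
qed (use assms(2) in \<open>auto intro!: AE_I2 intro: order_trans[OF _ abs_ge_self]\<close>)

lemma integrable_std_mv_normal_quadratic:
  fixes A :: "real^'d^'d"
  shows "integrable std_mv_normal (\<lambda>z. (a \<bullet> z) * ((b \<bullet> z) * ((A *v z) \<bullet> (A *v z)) ^ m))"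
    and "integrable std_mv_normal (\<lambda>z. ((A *v z) \<bullet> (A *v z)) ^ m)"
proof -
  have [measurable]: "(\<lambda>z. A *v z) \<in> borel_measurable borel"
    by (intro borel_measurable_continuous_onI linear_continuous_on matrix_vector_mul_bounded_linear)
  define \<alpha> where "\<alpha> = onorm ((*v) A)"
  have on: "norm (A *v v) \<le> \<alpha> * norm v" for v
    unfolding \<alpha>_def by (auto intro!: onorm matrix_vector_mul_bounded_linear)
  have W: "((A *v z) \<bullet> (A *v z)) ^ m \<le> \<alpha> ^ (2 * m) * norm z ^ (2 * m)" for z
  proof -
    have "((A *v z) \<bullet> (A *v z)) ^ m = norm (A *v z) ^ (2 * m)"
      by (simp add: power_mult power2_norm_eq_inner)
    also have "\<dots> \<le> (\<alpha> * norm z) ^ (2 * m)" by (intro power_mono on) simp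
    finally show ?thesis by (simp add: power_mult_distrib)
  qed
  show "integrable std_mv_normal (\<lambda>z. ((A *v z) \<bullet> (A *v z)) ^ m)"
    by (rule integrable_std_mv_normal_bound[where k=m and K="\<alpha> ^ (2 * m)"]) (use W in auto)
  show "integrable std_mv_normal (\<lambda>z. (a \<bullet> z) * ((b \<bullet> z) * ((A *v z) \<bullet> (A *v z)) ^ m))"
  proof (rule integrable_std_mv_normal_bound[where k="Suc m" and K="norm a * norm b * \<alpha> ^ (2 * m)"])
    fix z
    have "\<bar>(a \<bullet> z) * ((b \<bullet> z) * ((A *v z) \<bullet> (A *v z)) ^ m)\<bar>
      \<le> (norm a * norm z) * ((norm b * norm z) * (\<alpha> ^ (2 * m) * norm z ^ (2 * m)))"
      unfolding abs_mult using W[of z]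
      by (intro mult_mono Cauchy_Schwarz_ineq2) auto
    then show "\<bar>(a \<bullet> z) * ((b \<bullet> z) * ((A *v z) \<bullet> (A *v z)) ^ m)\<bar>
      \<le> norm a * norm b * \<alpha> ^ (2 * m) * norm z ^ (2 * Suc m)" by (simp add: mult_ac)
  qed measurable
qed

text \<open>Fubini integrates the coordinate \<open>i\<close> innermost. With the others fixed the
  integrand is a polynomial in one Gaussian variable, and the one-dimensional identity
  differentiates it.\<close>

lemma std_mv_normal_stein_coordinate:
  fixes A :: "real^'d^'d"
  shows "(\<integral>z. (axis i 1 \<bullet> z) * ((b \<bullet> z) * ((A *v z) \<bullet> (A *v z)) ^ m) \<partial>std_mv_normal)
    = (\<integral>z. b $ i * ((A *v z) \<bullet> (A *v z)) ^ m + 2 * real m *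
        ((transpose A *v (A *v axis i 1)) \<bullet> z * ((b \<bullet> z) * ((A *v z) \<bullet> (A *v z)) ^ (m - 1))) \<partial>std_mv_normal)"
    (is "(\<integral>z. ?F z \<partial>_) = (\<integral>z. ?H z \<partial>_)")
proof -
  let ?G = "\<lambda>I. \<Pi>\<^sub>M i\<in>(I :: 'd set). std_normal_distribution"
  let ?v = "\<lambda>z::'d \<Rightarrow> real. \<chi> i. z i"
  have intF: "integrable std_mv_normal ?F" by (rule integrable_std_mv_normal_quadratic)
  have intH: "integrable std_mv_normal ?H"
    by (intro Bochner_Integration.integrable_add integrable_mult_right integrable_std_mv_normal_quadratic)
  interpret product_sigma_finite "\<lambda>_::'d. std_normal_distribution"
    by (intro product_sigma_finite.intro prob_space_imp_sigma_finite prob_space_std_normal)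
  have U: "insert i (UNIV - {i}) = UNIV" by auto
  have fub: "(\<integral>z. f z \<partial>std_mv_normal) = (\<integral>x. \<integral>y. f (?v (x(i := y))) \<partial>std_normal_distribution \<partial>?G (UNIV - {i}))"
    if f: "integrable std_mv_normal f" for f :: "real^'d \<Rightarrow> real"
  proof -
    have m: "f \<in> borel_measurable borel" using borel_measurable_integrable[OF f] by simp
    have "integrable (?G UNIV) (\<lambda>z. f (?v z))"
      using f m unfolding std_mv_normal_def by (subst (asm) integrable_distr_eq[OF measurable_vec_lambda]) auto
    then have "(\<integral>z. f (?v z) \<partial>?G UNIV) = (\<integral>x. \<integral>y. f (?v (x(i := y))) \<partial>std_normal_distribution \<partial>?G (UNIV - {i}))"
      using product_integral_insert[of "UNIV - {i}" i "\<lambda>z. f (?v z)"] by (simp add: U)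
    moreover have "(\<integral>z. f z \<partial>std_mv_normal) = (\<integral>z. f (?v z) \<partial>?G UNIV)"
      unfolding std_mv_normal_def by (rule integral_distr[OF measurable_vec_lambda m])
    ultimately show ?thesis by simp
  qed
  have inner: "(\<integral>y. ?F (?v (x(i := y))) \<partial>std_normal_distribution) = (\<integral>y. ?H (?v (x(i := y))) \<partial>std_normal_distribution)"
    for x :: "'d \<Rightarrow> real"
  proof -
    \<comment> \<open>Base point of the line in direction \<open>?e\<close>: its coordinate
      \<open>i\<close> is 0, so that the first factor of the integrand is exactly \<open>y\<close>
      on the line.\<close>
    define x0 where "x0 = ?v (x(i := 0))"
    let ?e = "axis i 1 :: real^'d"
    have v: "?v (x(i := y)) = x0 + y *\<^sub>R ?e" for y
      by (simp add: x0_def vec_eq_iff axis_def)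
    have Av: "A *v (x0 + y *\<^sub>R ?e) = A *v x0 + y *\<^sub>R (A *v ?e)" for y
      by (simp add: matrix_vector_right_distrib linear_scale[OF matrix_vector_mul_linear])
    have e: "?e \<bullet> (x0 + y *\<^sub>R ?e) = y" for y
      by (simp add: inner_add_right inner_axis' x0_def)
    have b: "b \<bullet> (x0 + y *\<^sub>R ?e) = b \<bullet> x0 + y * b $ i" for y
      by (simp add: inner_add_right inner_axis)
    define q where "q = [:(A *v x0) \<bullet> (A *v x0), 2 * ((A *v ?e) \<bullet> (A *v x0)), (A *v ?e) \<bullet> (A *v ?e):]"
    have q: "poly q y = (A *v (x0 + y *\<^sub>R ?e)) \<bullet> (A *v (x0 + y *\<^sub>R ?e))" for y
      unfolding Av q_def by (simp add: inner_add algebra_simps inner_commute[of "A *v ?e" "A *v x0"])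
    have q': "poly (pderiv q) y = 2 * ((A *v ?e) \<bullet> (A *v (x0 + y *\<^sub>R ?e)))" for y
      unfolding Av q_def by (simp add: pderiv_pCons inner_add algebra_simps)
    \<comment> \<open>The product rule for \<open>p\<close> yields the two terms of
      \<open>?H\<close>. At \<open>m = 0\<close> the truncated \<open>m - 1\<close> is harmless,
      because that term carries the factor \<open>real m\<close>.\<close>
    define p where "p = [:b \<bullet> x0, b $ i:] * q ^ m"
    have F: "?F (?v (x(i := y))) = y * poly p y" for y
      unfolding v e p_def by (simp add: q b distrib_right)
    have t: "(transpose A *v (A *v ?e)) \<bullet> z = (A *v ?e) \<bullet> (A *v z)" for z
      by (metis dot_lmul_matrix inner_commute transpose_matrix_vector transpose_transpose)
    have H: "?H (?v (x(i := y))) = poly (pderiv p) y" for y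
    proof -
      have l: "pderiv [:b \<bullet> x0, b $ i:] = [:b $ i:]" by (simp add: pderiv_pCons)
      have "poly (pderiv p) y = (b \<bullet> x0 + y * b $ i) * (real m * poly q y ^ (m - 1) * poly (pderiv q) y)
          + poly q y ^ m * b $ i"
        by (simp only: p_def pderiv_mult l pderiv_power poly_add poly_mult poly_smult poly_power
            poly_pCons poly_0) simp
      then show ?thesis unfolding v t b q q' by (simp add: mult_ac)
    qed
    show ?thesis unfolding F H by (rule std_normal_stein_poly)
  qed
  show ?thesis unfolding fub[OF intF] fub[OF intH] inner ..
qed

lemma std_mv_normal_stein:
  fixes A :: "real^'d^'d"
  shows "(\<integral>z. (a \<bullet> z) * ((b \<bullet> z) * ((A *v z) \<bullet> (A *v z)) ^ m) \<partial>std_mv_normal)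
    = (a \<bullet> b) * (\<integral>z. ((A *v z) \<bullet> (A *v z)) ^ m \<partial>std_mv_normal) + 2 * real m *
       (\<integral>z. (transpose A *v (A *v a)) \<bullet> z * ((b \<bullet> z) * ((A *v z) \<bullet> (A *v z)) ^ (m - 1)) \<partial>std_mv_normal)"
proof -
  note int = integrable_std_mv_normal_quadratic
  let ?W = "\<lambda>z. (A *v z) \<bullet> (A *v z)"
  let ?B = "\<lambda>a m. \<integral>z. (a \<bullet> z) * ((b \<bullet> z) * ?W z ^ m) \<partial>std_mv_normal"
  \<comment> \<open>A general linear \<open>f\<close> lets the fact be used twice: with the identity
    to split the left side into coordinates, and with \<open>transpose A *v (A *v a)\<close> to
    reassemble the remainder.\<close>
  have lin: "?B (f a) m = (\<Sum>i\<in>UNIV. a $ i * ?B (f (axis i 1)) m)" if f: "linear f" for m and f :: "real^'d \<Rightarrow> real^'d"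
  proof -
    have "f a = (\<Sum>i\<in>UNIV. a $ i *\<^sub>R f (axis i 1))"
      using basis_expansion[of a]
      by (metis (no_types, lifting) f linear_scale linear_sum scalar_mult_eq_scaleR sum.cong)
    then have "?B (f a) m = (\<integral>z. (\<Sum>i\<in>UNIV. a $ i * ((f (axis i 1) \<bullet> z) * ((b \<bullet> z) * ?W z ^ m))) \<partial>std_mv_normal)"
      by (simp add: inner_sum_left sum_distrib_right mult.assoc)
    also have "\<dots> = (\<Sum>i\<in>UNIV. a $ i * ?B (f (axis i 1)) m)"
      by (simp only: Bochner_Integration.integral_sum[OF integrable_mult_right[OF int(1)]]
          integral_mult_right_zero)
    finally show ?thesis .
  qed
  have "?B a m = (\<Sum>i\<in>UNIV. a $ i * ?B (axis i 1) m)" using lin[of "\<lambda>x. x" m] by (simp add: linear_id[unfolded id_def])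
  also have "\<dots> = (\<Sum>i\<in>UNIV. a $ i * (b $ i * (\<integral>z. ?W z ^ m \<partial>std_mv_normal)
      + 2 * real m * ?B (transpose A *v (A *v axis i 1)) (m - 1)))"
    unfolding std_mv_normal_stein_coordinate
    by (simp only: Bochner_Integration.integral_add[OF integrable_mult_right[OF int(2)]
          integrable_mult_right[OF int(1)]] integral_mult_right_zero)
  also have "\<dots> = (a \<bullet> b) * (\<integral>z. ?W z ^ m \<partial>std_mv_normal)
      + 2 * real m * (\<Sum>i\<in>UNIV. a $ i * ?B (transpose A *v (A *v axis i 1)) (m - 1))"
    by (simp add: distrib_left sum.distrib inner_vec_def sum_distrib_left sum_distrib_right mult_ac)
  also have "(\<Sum>i\<in>UNIV. a $ i * ?B (transpose A *v (A *v axis i 1)) (m - 1)) = ?B (transpose A *v (A *v a)) (m - 1)"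
    by (rule lin[symmetric, of "\<lambda>a. transpose A *v (A *v a)"],
        rule linear_compose[OF matrix_vector_mul_linear matrix_vector_mul_linear, unfolded o_def])
  finally show ?thesis .
qed

lemma prob_space_mv_normal: "prob_space (mv_normal C)"
  and sets_mv_normal [simp, measurable_cong]: "sets (mv_normal C) = sets borel"
proof -
  have m: "(\<lambda>z. A *v z) \<in> borel_measurable std_mv_normal" for A :: "real^'d^'d"
    unfolding measurable_cong_sets[OF sets_std_mv_normal refl]
    by (intro borel_measurable_continuous_onI linear_continuous_on matrix_vector_mul_bounded_linear)
  show "prob_space (mv_normal C)" unfolding mv_normal_def
    by (intro prob_space.prob_space_distr prob_space_std_mv_normal m)
qed (simp add: mv_normal_def)

lemma space_mv_normal [simp]: "space (mv_normal C) = UNIV"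
  using sets_eq_imp_space_eq[OF sets_mv_normal] by simp

section \<open>Gaussian moments weighted by powers of the squared norm\<close>

definition radial_moment :: "real^'d^'d \<Rightarrow> nat \<Rightarrow> real" where
  "radial_moment C m = (\<integral>\<xi>. (\<xi> \<bullet> \<xi>) ^ m \<partial>mv_normal C)"

text \<open>The bilinear form of the matrix M_m, the expectation of |\<xi>|^(2m) times \<xi>
  \<xi>^T. Working with the form avoids matrix-valued integrals.\<close>

definition mixed_moment :: "real^'d^'d \<Rightarrow> nat \<Rightarrow> real^'d \<Rightarrow> real^'d \<Rightarrow> real" where
  "mixed_moment C m u v = (\<integral>\<xi>. (u \<bullet> \<xi>) * ((v \<bullet> \<xi>) * (\<xi> \<bullet> \<xi>) ^ m) \<partial>mv_normal C)"

text \<open>Substituting \<xi> = A z replaces \<open>u\<close> by \<open>transpose A *v u\<close>,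
  and \<open>A ** transpose A = C\<close> eliminates the root. For the matrix M_m behind
  \<open>mixed_moment\<close> and the radial moment R_m, Stein's identity reads M_m = R_m C + 2 m C
  M_(m-1).\<close>

lemma
  fixes C :: "real^'d^'d"
  shows integrable_radial: "integrable (mv_normal C) (\<lambda>\<xi>. (\<xi> \<bullet> \<xi>) ^ m)"
    and integrable_mixed: "integrable (mv_normal C) (\<lambda>\<xi>. (u \<bullet> \<xi>) * ((v \<bullet> \<xi>) * (\<xi> \<bullet> \<xi>) ^ m))"
    and mixed_moment_stein: "symmetric_mat C \<Longrightarrow> pos_semidef C \<Longrightarrow>
      mixed_moment C m u v = (u \<bullet> (C *v v)) * radial_moment C m + 2 * real m * mixed_moment C (m - 1) (C *v u) v"
proof -
  define A :: "real^'d^'d" where "A = (SOME A. A ** transpose A = C)"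
  have m: "(\<lambda>z. A *v z) \<in> borel_measurable std_mv_normal"
    unfolding measurable_cong_sets[OF sets_std_mv_normal refl]
    by (intro borel_measurable_continuous_onI linear_continuous_on matrix_vector_mul_bounded_linear)
  have N: "mv_normal C = distr std_mv_normal borel (\<lambda>z. A *v z)" by (simp add: mv_normal_def A_def)
  have t: "u \<bullet> (A *v z) = (transpose A *v u) \<bullet> z" for u z
    by (metis dot_lmul_matrix transpose_matrix_vector)
  show "integrable (mv_normal C) (\<lambda>\<xi>. (\<xi> \<bullet> \<xi>) ^ m)"
    unfolding N by (subst integrable_distr_eq[OF m]) (auto intro: integrable_std_mv_normal_quadratic)
  show "integrable (mv_normal C) (\<lambda>\<xi>. (u \<bullet> \<xi>) * ((v \<bullet> \<xi>) * (\<xi> \<bullet> \<xi>) ^ m))"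
    unfolding N
  proof (subst integrable_distr_eq[OF m])
    show "integrable std_mv_normal (\<lambda>z. (u \<bullet> (A *v z)) * ((v \<bullet> (A *v z)) * ((A *v z) \<bullet> (A *v z)) ^ m))"
      unfolding t[of u] t[of v] by (rule integrable_std_mv_normal_quadratic)
  qed measurable
  have r: "radial_moment C m = (\<integral>z. ((A *v z) \<bullet> (A *v z)) ^ m \<partial>std_mv_normal)" for m
    unfolding radial_moment_def N by (rule integral_distr[OF m]) simp
  have x: "mixed_moment C m u v = (\<integral>z. ((transpose A *v u) \<bullet> z) *
      (((transpose A *v v) \<bullet> z) * ((A *v z) \<bullet> (A *v z)) ^ m) \<partial>std_mv_normal)" for m u v
  proof -
    have f: "(\<lambda>\<xi>. (u \<bullet> \<xi>) * ((v \<bullet> \<xi>) * (\<xi> \<bullet> \<xi>) ^ m)) \<in> borel_measurable borel" by measurable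
    show ?thesis unfolding mixed_moment_def N integral_distr[OF m f] t[of u] t[of v] ..
  qed
  assume "symmetric_mat C" "pos_semidef C"
  then have C: "A ** transpose A = C" unfolding A_def by (rule someI_ex[OF psd_sqrt_exists])
  have c: "A *v (transpose A *v u) = C *v u" for u by (simp only: matrix_vector_mul_assoc C)
  have "(transpose A *v u) \<bullet> (transpose A *v v) = u \<bullet> (C *v v)" by (simp only: t[symmetric] c)
  then show "mixed_moment C m u v = (u \<bullet> (C *v v)) * radial_moment C m + 2 * real m * mixed_moment C (m - 1) (C *v u) v"
    unfolding x r by (subst std_mv_normal_stein) (simp only: c)
qed

lemma radial_moment_0 [simp]: "radial_moment C 0 = 1"
  using prob_space.prob_space[OF prob_space_mv_normal] by (simp add: radial_moment_def)

lemma radial_moment_nonneg: "0 \<le> radial_moment C m"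
  unfolding radial_moment_def by (rule Bochner_Integration.integral_nonneg) simp

lemma mixed_moment_commute: "mixed_moment C m u v = mixed_moment C m v u"
  unfolding mixed_moment_def by (simp add: mult.left_commute)

context
  fixes C :: "real^'d^'d"
  assumes sym: "symmetric_mat C" and psd: "pos_semidef C"
begin

text \<open>The weighted covariance commutes with \<open>C\<close>. Stein's identity one level
  higher, for \<open>u, v\<close> and for \<open>v, u\<close>, has equal left sides and equal
  leading terms, hence equal remainders.\<close>

lemma mixed_moment_self_adjoint: "mixed_moment C m (C *v u) v = mixed_moment C m u (C *v v)"
proof -
  have "u \<bullet> (C *v v) = v \<bullet> (C *v u)" using symmetric_mat_inner[OF sym, of u v] by (simp add: inner_commute)
  then have "mixed_moment C m (C *v u) v = mixed_moment C m (C *v v) u"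
    using mixed_moment_stein[OF sym psd, of "Suc m" u v] mixed_moment_stein[OF sym psd, of "Suc m" v u]
    by (simp add: mixed_moment_commute[of C "Suc m" u v])
  then show ?thesis by (simp add: mixed_moment_commute)
qed

lemma norm_psd_mult_vec_le: "(C *v v) \<bullet> (C *v v) \<le> eigval 1 C * (v \<bullet> (C *v v))"
proof -
  obtain u a where e: "eigbasis C u a" using sym by (rule symmetric_mat_eigbasis)
  have a: "0 \<le> a i" "a i \<le> eigval 1 C" for i
    using psd[unfolded pos_semidef_def, rule_format, of "u i"] eigval_1_ge[OF sym, of "u i"]
    by (simp_all add: eigbasisD[OF e])
  have "(C *v v) \<bullet> (C *v v) = (\<Sum>i\<in>UNIV. a i * (a i * (u i \<bullet> v) * (u i \<bullet> v)))"
    by (subst eigbasis_inner[OF e]) (simp add: eigbasis_mult_vec[OF e] mult_ac)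
  also have "\<dots> \<le> (\<Sum>i\<in>UNIV. eigval 1 C * (a i * (u i \<bullet> v) * (u i \<bullet> v)))"
    using a by (intro sum_mono mult_right_mono) (auto simp: mult.assoc)
  also have "\<dots> = eigval 1 C * (v \<bullet> (C *v v))"
    unfolding eigbasis_inner_mult_vec[OF e] by (simp add: sum_distrib_left)
  finally show ?thesis .
qed

lemma radial_moment_Suc:
  assumes "eigbasis C u a"
  shows "radial_moment C (Suc m) = (\<Sum>i\<in>UNIV. mixed_moment C m (u i) (u i))"
proof -
  have "(\<Sum>i\<in>UNIV. mixed_moment C m (u i) (u i))
      = (\<integral>\<xi>. (\<Sum>i\<in>UNIV. (u i \<bullet> \<xi>) * ((u i \<bullet> \<xi>) * (\<xi> \<bullet> \<xi>) ^ m)) \<partial>mv_normal C)"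
    unfolding mixed_moment_def by (intro Bochner_Integration.integral_sum[symmetric] integrable_mixed)
  also have "(\<lambda>\<xi>. \<Sum>i\<in>UNIV. (u i \<bullet> \<xi>) * ((u i \<bullet> \<xi>) * (\<xi> \<bullet> \<xi>) ^ m)) = (\<lambda>\<xi>. (\<xi> \<bullet> \<xi>) ^ Suc m)"
  proof
    fix \<xi>
    have "(\<Sum>i\<in>UNIV. (u i \<bullet> \<xi>) * ((u i \<bullet> \<xi>) * (\<xi> \<bullet> \<xi>) ^ m))
        = (\<Sum>i\<in>UNIV. (u i \<bullet> \<xi>) * (u i \<bullet> \<xi>)) * (\<xi> \<bullet> \<xi>) ^ m"
      by (simp add: sum_distrib_right mult.assoc)
    then show "(\<Sum>i\<in>UNIV. (u i \<bullet> \<xi>) * ((u i \<bullet> \<xi>) * (\<xi> \<bullet> \<xi>) ^ m)) = (\<xi> \<bullet> \<xi>) ^ Suc m"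
      by (simp add: eigbasis_inner[OF assms, symmetric])
  qed
  finally show ?thesis by (simp add: radial_moment_def)
qed

lemma trace_nonneg: "0 \<le> trace C"
proof -
  obtain u a where e: "eigbasis C u a" using sym by (rule symmetric_mat_eigbasis)
  show ?thesis unfolding eigbasis_trace[OF e]
    using psd by (intro sum_nonneg) (simp add: pos_semidef_def)
qed

lemma eigval_1_nonneg: "0 \<le> eigval 1 C"
proof (rule ccontr)
  assume neg: "\<not> 0 \<le> eigval 1 C"
  let ?e = "axis undefined 1 :: real^'d"
  have "0 \<le> ?e \<bullet> (C *v ?e)" using psd by (simp add: pos_semidef_def)
  also have "\<dots> \<le> eigval 1 C * (?e \<bullet> ?e)" by (rule eigval_1_ge[OF sym])
  also have "?e \<bullet> ?e = 1" by (simp add: inner_axis)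
  finally show False using neg by simp
qed

lemma radial_moment_Suc_le:
  assumes "\<And>v. mixed_moment C m v v \<le> b * (v \<bullet> (C *v v))"
  shows "radial_moment C (Suc m) \<le> b * trace C"
proof -
  obtain u a where e: "eigbasis C u a" using sym by (rule symmetric_mat_eigbasis)
  show ?thesis unfolding radial_moment_Suc[OF e] eigbasis_trace[OF e] sum_distrib_left
    by (intro sum_mono assms)
qed

text \<open>Write M_m for the matrix behind \<open>mixed_moment\<close> and L for
  \<open>eigval 1 C\<close>. The first two bounds are M_m \<le> b_m C and C M_m \<le> b_m C^2 as
  forms. They are proved together because the Stein step for the first produces C M_k, then
  controlled by b_k C^2 \<le> b_k L C. Tracing the first bound controls the next radial moment, so
  passing from k to k + 1 costs the factor tr C + 2 (k + 1) L.\<close>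

lemma mixed_moment_bounds:
  defines "b \<equiv> \<lambda>m. \<Prod>k=1..m. trace C + 2 * real k * eigval 1 C"
  shows "mixed_moment C m v v \<le> b m * (v \<bullet> (C *v v))"
    and "mixed_moment C m (C *v v) v \<le> b m * ((C *v v) \<bullet> (C *v v))"
    and "radial_moment C m \<le> b m"
    and "radial_moment C (Suc m) \<le> b m * trace C"
proof -
  let ?L = "eigval 1 C"
  note pos = trace_nonneg eigval_1_nonneg
  have b0: "0 \<le> b k" for k unfolding b_def using pos by (intro prod_nonneg) auto
  have b_Suc: "b (Suc k) = b k * (trace C + 2 * real (Suc k) * ?L)" for k
    by (simp add: b_def)
  have adj: "(C *v v) \<bullet> w = v \<bullet> (C *v w)" for v w by (rule symmetric_mat_inner[OF sym])
  have stein: "mixed_moment C (Suc k) u v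
      = (u \<bullet> (C *v v)) * radial_moment C (Suc k) + 2 * real (Suc k) * mixed_moment C k (C *v u) v" for k u v
    using mixed_moment_stein[OF sym psd, of "Suc k" u v] by simp
  have m0: "mixed_moment C 0 u v = u \<bullet> (C *v v)" for u v
    using mixed_moment_stein[OF sym psd, of 0 u v] by simp
  have main: "(\<forall>v. mixed_moment C k v v \<le> b k * (v \<bullet> (C *v v))) \<and>
      (\<forall>v. mixed_moment C k (C *v v) v \<le> b k * ((C *v v) \<bullet> (C *v v)))" for k
  proof (induction k)
    case 0
    then show ?case by (simp add: m0 b_def adj)
  next
    case (Suc k)
    have w: "radial_moment C (Suc k) \<le> b k * trace C"
      by (rule radial_moment_Suc_le) (use Suc in blast)
    show ?case
    proof (intro conjI allI)
      fix v
      have "mixed_moment C (Suc k) v v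
          \<le> (v \<bullet> (C *v v)) * (b k * trace C) + 2 * real (Suc k) * (b k * (?L * (v \<bullet> (C *v v))))"
        unfolding stein
        using psd w Suc b0[of k] norm_psd_mult_vec_le[of v]
        by (intro add_mono mult_left_mono) (auto simp: pos_semidef_def intro: order_trans mult_left_mono)
      then show "mixed_moment C (Suc k) v v \<le> b (Suc k) * (v \<bullet> (C *v v))"
        unfolding b_Suc by (simp add: algebra_simps)
      \<comment> \<open>Commutation with \<open>C\<close> moves one factor across, giving the
        weighted covariance evaluated twice at \<open>C *v v\<close>, where the first induction
        bound applies.\<close>
      have "mixed_moment C k (C *v (C *v v)) v \<le> b k * (?L * ((C *v v) \<bullet> (C *v v)))"
      proof -
        have "mixed_moment C k (C *v (C *v v)) v = mixed_moment C k (C *v v) (C *v v)"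
          by (rule mixed_moment_self_adjoint)
        also have "\<dots> \<le> b k * ((C *v v) \<bullet> (C *v (C *v v)))" using Suc by blast
        also have "\<dots> \<le> b k * (?L * ((C *v v) \<bullet> (C *v v)))"
          using b0 eigval_1_ge[OF sym] by (intro mult_left_mono) auto
        finally show ?thesis .
      qed
      then have "mixed_moment C (Suc k) (C *v v) v \<le> ((C *v v) \<bullet> (C *v v)) * (b k * trace C)
          + 2 * real (Suc k) * (b k * (?L * ((C *v v) \<bullet> (C *v v))))"
        unfolding stein using w by (intro add_mono mult_left_mono) auto
      then show "mixed_moment C (Suc k) (C *v v) v \<le> b (Suc k) * ((C *v v) \<bullet> (C *v v))"
        unfolding b_Suc by (simp add: algebra_simps)
    qed
  qed
  show "mixed_moment C m v v \<le> b m * (v \<bullet> (C *v v))"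
    and "mixed_moment C m (C *v v) v \<le> b m * ((C *v v) \<bullet> (C *v v))" using main by blast+
  have w: "radial_moment C (Suc k) \<le> b k * trace C" for k
    by (rule radial_moment_Suc_le) (use main in blast)
  show "radial_moment C (Suc m) \<le> b m * trace C" by (rule w)
  show "radial_moment C m \<le> b m"
  proof (cases m)
    case 0 then show ?thesis by (simp add: b_def)
  next
    case (Suc k)
    have "b k * trace C \<le> b (Suc k)" unfolding b_Suc using pos b0 by (intro mult_left_mono) auto
    then show ?thesis using w[of k] Suc by simp
  qed
qed

text \<open>The square of \<open>\<xi> \<xi>\<^sup>T - C\<close> produces the cross term \<open>- 2 mixed_moment C m (C v) v\<close>, which cancels
  part of the Stein expansion of the leading term; this is what brings the variance down from
  \<open>r + 2\<close> to \<open>r + 1\<close>.\<close>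
lemma weighted_square_moment:
  shows "(\<integral>\<xi>. (\<xi> \<bullet> \<xi>) ^ m * (norm ((\<xi> \<bullet> v) *\<^sub>R \<xi> - C *v v))\<^sup>2 \<partial>mv_normal C)
    = (v \<bullet> (C *v v)) * radial_moment C (Suc m) + 2 * real m * mixed_moment C m (C *v v) v
      + ((C *v v) \<bullet> (C *v v)) * radial_moment C m"
    and "integrable (mv_normal C) (\<lambda>\<xi>. (\<xi> \<bullet> \<xi>) ^ m * (norm ((\<xi> \<bullet> v) *\<^sub>R \<xi> - C *v v))\<^sup>2)"
proof -
  let ?Cv = "C *v v"
  have eq: "(\<lambda>\<xi>. (\<xi> \<bullet> \<xi>) ^ m * (norm ((\<xi> \<bullet> v) *\<^sub>R \<xi> - ?Cv))\<^sup>2)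
    = (\<lambda>\<xi>. (v \<bullet> \<xi>) * ((v \<bullet> \<xi>) * (\<xi> \<bullet> \<xi>) ^ Suc m) - 2 * ((?Cv \<bullet> \<xi>) * ((v \<bullet> \<xi>) * (\<xi> \<bullet> \<xi>) ^ m))
      + (?Cv \<bullet> ?Cv) * (\<xi> \<bullet> \<xi>) ^ m)"
    by (rule ext) (simp add: power2_norm_eq_inner inner_diff inner_commute algebra_simps)
  have int: "integrable (mv_normal C) (\<lambda>\<xi>. (v \<bullet> \<xi>) * ((v \<bullet> \<xi>) * (\<xi> \<bullet> \<xi>) ^ Suc m))"
    "integrable (mv_normal C) (\<lambda>\<xi>. 2 * ((?Cv \<bullet> \<xi>) * ((v \<bullet> \<xi>) * (\<xi> \<bullet> \<xi>) ^ m)))"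
    "integrable (mv_normal C) (\<lambda>\<xi>. (?Cv \<bullet> ?Cv) * (\<xi> \<bullet> \<xi>) ^ m)"
    by (intro integrable_mult_right integrable_mixed integrable_radial)+
  show "integrable (mv_normal C) (\<lambda>\<xi>. (\<xi> \<bullet> \<xi>) ^ m * (norm ((\<xi> \<bullet> v) *\<^sub>R \<xi> - C *v v))\<^sup>2)"
    unfolding eq by (intro Bochner_Integration.integrable_add Bochner_Integration.integrable_diff int)
  have "(\<integral>\<xi>. (\<xi> \<bullet> \<xi>) ^ m * (norm ((\<xi> \<bullet> v) *\<^sub>R \<xi> - ?Cv))\<^sup>2 \<partial>mv_normal C)
    = mixed_moment C (Suc m) v v - 2 * mixed_moment C m ?Cv v + (?Cv \<bullet> ?Cv) * radial_moment C m"
    unfolding eq Bochner_Integration.integral_add[OF Bochner_Integration.integrable_diff[OF int(1,2)] int(3)]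
      Bochner_Integration.integral_diff[OF int(1,2)] integral_mult_right_zero
      mixed_moment_def radial_moment_def ..
  also have "mixed_moment C (Suc m) v v
      = (v \<bullet> ?Cv) * radial_moment C (Suc m) + 2 * real (Suc m) * mixed_moment C m ?Cv v"
    using mixed_moment_stein[OF sym psd, of "Suc m" v v] by simp
  finally show "(\<integral>\<xi>. (\<xi> \<bullet> \<xi>) ^ m * (norm ((\<xi> \<bullet> v) *\<^sub>R \<xi> - C *v v))\<^sup>2 \<partial>mv_normal C)
    = (v \<bullet> ?Cv) * radial_moment C (Suc m) + 2 * real m * mixed_moment C m ?Cv v
      + (?Cv \<bullet> ?Cv) * radial_moment C m" by (simp add: algebra_simps)
qed

section \<open>Bernstein condition for the centred square\<close>

lemma prod_odd_le: "2 * (\<Prod>k=1..q. 2 * real k + 1) \<le> (real q + 2) * fact q * 2 ^ q"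
proof (induction q)
  case (Suc q)
  have "2 * (\<Prod>k=1..Suc q. 2 * real k + 1) = (2 * (\<Prod>k=1..q. 2 * real k + 1)) * (2 * real q + 3)"
    by (simp add: algebra_simps)
  also have "\<dots> \<le> ((real q + 2) * fact q * 2 ^ q) * (2 * real q + 3)"
    by (rule mult_right_mono[OF Suc]) simp
  also have "\<dots> = (fact q * 2 ^ q) * ((real q + 2) * (2 * real q + 3))" by (simp add: mult_ac)
  \<comment> \<open>The two sides of the polynomial inequality differ by exactly q; the product
    being bounded is the double factorial of 2 q + 1.\<close>
  also have "\<dots> \<le> (fact q * 2 ^ q) * (2 * (real q + 3) * (real q + 1))"
    by (intro mult_left_mono) (auto simp: algebra_simps)
  also have "\<dots> = (real (Suc q) + 2) * fact (Suc q) * 2 ^ Suc q" by (simp add: algebra_simps)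
  finally show ?case .
qed simp

text \<open>Since \<open>1 \<le> r\<close>, each \<open>r + 2 * real k\<close> is at most
  \<open>r * (2 * real k + 1)\<close> and the first factor is at most
  \<open>(r + 1) * (real q + 1)\<close>. The latter supplies the factor \<open>q + 1\<close> that
  completes \<open>(q + 2) * fact q\<close> to \<open>fact (q + 2)\<close>.\<close>

lemma moment_factor_le:
  fixes r :: real
  assumes "1 \<le> r"
  shows "(r + 2 * real q + 1) * (\<Prod>k=1..q. r + 2 * real k) \<le> fact (q + 2) / 2 * (2 * r) ^ q * (r + 1)"
proof -
  have "(\<Prod>k=1..q. r + 2 * real k) \<le> (\<Prod>k=1..q. r * (2 * real k + 1))"
  proof (intro prod_mono conjI)
    fix k
    have "2 * real k * 1 \<le> 2 * real k * r" by (intro mult_left_mono assms) simp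
    then show "r + 2 * real k \<le> r * (2 * real k + 1)" by (simp add: algebra_simps)
  qed (use assms in auto)
  also have "\<dots> = r ^ q * (\<Prod>k=1..q. 2 * real k + 1)" by (simp add: prod.distrib)
  also have "\<dots> \<le> r ^ q * ((real q + 2) * fact q * 2 ^ q / 2)"
    using prod_odd_le[of q] assms by (intro mult_left_mono) auto
  finally have p: "(\<Prod>k=1..q. r + 2 * real k) \<le> r ^ q * ((real q + 2) * fact q * 2 ^ q / 2)" .
  have "real q * 1 \<le> real q * r" by (intro mult_left_mono assms) simp
  then have "r + 2 * real q + 1 \<le> (r + 1) * (real q + 1)" by (simp add: algebra_simps)
  then have "(r + 2 * real q + 1) * (\<Prod>k=1..q. r + 2 * real k)
      \<le> ((r + 1) * (real q + 1)) * (r ^ q * ((real q + 2) * fact q * 2 ^ q / 2))"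
    using assms by (intro mult_mono p prod_nonneg) auto
  also have "\<dots> = fact (q + 2) / 2 * (2 * r) ^ q * (r + 1)"
    by (simp add: power_mult_distrib algebra_simps)
  finally show ?thesis .
qed

lemma weighted_square_moment_le:
  assumes "0 < eigval 1 C"
  defines "r \<equiv> trace C / eigval 1 C"
  shows "(\<integral>\<xi>. (\<xi> \<bullet> \<xi>) ^ m * (norm ((\<xi> \<bullet> v) *\<^sub>R \<xi> - C *v v))\<^sup>2 \<partial>mv_normal C)
    \<le> fact (m + 2) / 2 * (2 * r) ^ m * (r + 1) * eigval 1 C ^ (m + 2) * (v \<bullet> v)"
proof -
  define L where "L = eigval 1 C"
  define b where "b = (\<Prod>k=1..m. trace C + 2 * real k * eigval 1 C)"
  have L: "0 < L" and tr: "trace C = r * L" using assms by (auto simp: L_def)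
  have r1: "1 \<le> r" unfolding r_def using assms(1) eigval_1_le_trace[OF sym psd] by simp
  have b: "b = L ^ m * (\<Prod>k=1..m. r + 2 * real k)"
  proof -
    have "b = (\<Prod>k=1..m. L * (r + 2 * real k))"
      unfolding b_def tr L_def[symmetric] by (intro prod.cong refl) (simp add: algebra_simps)
    then show ?thesis by (simp add: prod.distrib)
  qed
  have b0: "0 \<le> b" unfolding b using L r1 by (auto intro!: mult_nonneg_nonneg prod_nonneg)
  note bd = mixed_moment_bounds[where m=m, folded b_def]
  let ?Cv = "C *v v"
  have vC: "0 \<le> v \<bullet> ?Cv" "v \<bullet> ?Cv \<le> L * (v \<bullet> v)"
    using psd eigval_1_ge[OF sym, of v] by (auto simp: pos_semidef_def L_def)
  have CC: "?Cv \<bullet> ?Cv \<le> L * (L * (v \<bullet> v))"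
    using norm_psd_mult_vec_le[of v] mult_left_mono[OF vC(2), of L] L unfolding L_def by linarith
  have "(v \<bullet> ?Cv) * radial_moment C (Suc m) + 2 * real m * mixed_moment C m ?Cv v
      + (?Cv \<bullet> ?Cv) * radial_moment C m
    \<le> (L * (v \<bullet> v)) * (b * trace C) + 2 * real m * (b * (L * (L * (v \<bullet> v)))) + (L * (L * (v \<bullet> v))) * b"
  proof (intro add_mono)
    show "(v \<bullet> ?Cv) * radial_moment C (Suc m) \<le> (L * (v \<bullet> v)) * (b * trace C)"
      using vC bd(4) radial_moment_nonneg L by (intro mult_mono) auto
    have "mixed_moment C m ?Cv v \<le> b * (L * (L * (v \<bullet> v)))"
      using bd(2)[of v] mult_left_mono[OF CC b0] by linarith
    then show "2 * real m * mixed_moment C m ?Cv v \<le> 2 * real m * (b * (L * (L * (v \<bullet> v))))"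
      by (intro mult_left_mono) auto
    show "(?Cv \<bullet> ?Cv) * radial_moment C m \<le> (L * (L * (v \<bullet> v))) * b"
      using CC bd(3) radial_moment_nonneg L by (intro mult_mono) auto
  qed
  \<comment> \<open>After scaling by \<open>L\<close>, the summand \<open>r\<close> comes from the
    radial term, \<open>2 * real m\<close> from the mixed term and 1 from the squared norm of
    \<open>?Cv\<close>.\<close>
  also have "\<dots> = ((r + 2 * real m + 1) * (\<Prod>k=1..m. r + 2 * real k)) * (L ^ (m + 2) * (v \<bullet> v))"
    unfolding tr b by (simp add: algebra_simps power2_eq_square)
  also have "\<dots> \<le> (fact (m + 2) / 2 * (2 * r) ^ m * (r + 1)) * (L ^ (m + 2) * (v \<bullet> v))"
    using L by (intro mult_right_mono moment_factor_le r1) auto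
  finally show ?thesis unfolding weighted_square_moment(1) L_def by (simp add: mult.assoc)
qed

end

section \<open>Matrix Laplace transforms\<close>

text \<open>For \<open>0 \<le> x\<close> the Taylor terms are compared one by one, using
  \<open>x ^ q \<le> b ^ q\<close>; for negative \<open>x\<close> the term
  \<open>l\<^sup>2 / 2\<close> alone is enough. The coefficient is (exp (l b) - 1 - l b) / b^2 when
  b is nonzero; as a series it covers \<open>b = 0\<close> and can be integrated termwise when
  \<open>b\<close> is random.\<close>

lemma exp_le_quadratic:
  fixes x b l :: real
  assumes xb: "x \<le> b" and b: "0 \<le> b" and l: "0 \<le> l"
  shows "summable (\<lambda>q. l ^ (q + 2) / fact (q + 2) * b ^ q)"
    and "exp (l * x) \<le> 1 + l * x + x\<^sup>2 * (\<Sum>q. l ^ (q + 2) / fact (q + 2) * b ^ q)"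
proof -
  let ?g = "\<lambda>q. l ^ (q + 2) / fact (q + 2) * b ^ q"
  have g0: "0 \<le> ?g q" for q using b l by simp
  show s: "summable ?g"
  proof (rule summable_comparison_test)
    show "summable (\<lambda>q. l\<^sup>2 * (inverse (fact q) * (l * b) ^ q))"
      by (intro summable_mult summable_exp)
    have "norm (?g q) \<le> l\<^sup>2 * (inverse (fact q) * (l * b) ^ q)" for q
    proof -
      have "norm (?g q) = (l ^ (q + 2) * b ^ q) * inverse (fact (q + 2))"
        using g0[of q] by (simp add: divide_inverse)
      also have "\<dots> \<le> (l ^ (q + 2) * b ^ q) * inverse (fact q)"
        using b l by (intro mult_left_mono le_imp_inverse_le fact_mono) auto
      also have "\<dots> = l\<^sup>2 * (inverse (fact q) * (l * b) ^ q)"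
        by (simp add: power_mult_distrib power_add power2_eq_square mult_ac)
      finally show ?thesis .
    qed
    then show "\<exists>N. \<forall>q\<ge>N. norm (?g q) \<le> l\<^sup>2 * (inverse (fact q) * (l * b) ^ q)" by blast
  qed
  show "exp (l * x) \<le> 1 + l * x + x\<^sup>2 * (\<Sum>q. ?g q)"
  proof (cases "0 \<le> x")
    case True
    have sx: "summable (\<lambda>n. (l * x) ^ n /\<^sub>R fact n)" by (rule summable_exp_generic)
    have "exp (l * x) = (\<Sum>q. (l * x) ^ (q + 2) /\<^sub>R fact (q + 2)) + (\<Sum>i<2. (l * x) ^ i /\<^sub>R fact i)"
      unfolding exp_def by (rule suminf_split_initial_segment[OF sx])
    also have "(\<Sum>i<2. (l * x) ^ i /\<^sub>R fact i) = 1 + l * x" by (simp add: numeral_2_eq_2)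
    also have "(\<Sum>q. (l * x) ^ (q + 2) /\<^sub>R fact (q + 2)) \<le> (\<Sum>q. x\<^sup>2 * ?g q)"
    proof (rule suminf_le)
      show "(l * x) ^ (q + 2) /\<^sub>R fact (q + 2) \<le> x\<^sup>2 * ?g q" for q
      proof -
        have "(l * x) ^ (q + 2) /\<^sub>R fact (q + 2) = x\<^sup>2 * (l ^ (q + 2) / fact (q + 2) * x ^ q)"
          by (simp add: power_mult_distrib power_add power2_eq_square divide_inverse mult_ac)
        also have "\<dots> \<le> x\<^sup>2 * ?g q"
          using True xb l by (intro mult_left_mono power_mono) auto
        finally show ?thesis .
      qed
      show "summable (\<lambda>q. (l * x) ^ (q + 2) /\<^sub>R fact (q + 2))"
        using sx by (subst summable_iff_shift)
      show "summable (\<lambda>q. x\<^sup>2 * ?g q)" by (intro summable_mult s)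
    qed
    also have "(\<Sum>q. x\<^sup>2 * ?g q) = x\<^sup>2 * (\<Sum>q. ?g q)" by (rule suminf_mult[OF s])
    finally show ?thesis by simp
  next
    case False
    define y where "y = l * x"
    have y: "y \<le> 0" unfolding y_def using False l by (simp add: mult_nonneg_nonpos)
    \<comment> \<open>The cubic Lagrange remainder is nonpositive for \<open>y \<le> 0\<close>, so
      the quadratic Taylor polynomial is an upper bound.\<close>
    obtain t where t: "exp y = (\<Sum>m<3. y ^ m / fact m) + exp t / fact 3 * y ^ 3"
      using Maclaurin_exp_le[of y 3] by blast
    have "exp t / fact 3 * y ^ 3 \<le> 0"
      using y by (intro mult_nonneg_nonpos) (auto simp: power_le_zero_eq)
    then have "exp y \<le> 1 + y + y\<^sup>2 / 2"
      unfolding t by (simp add: numeral_3_eq_3 numeral_2_eq_2)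
    also have "y\<^sup>2 / 2 = x\<^sup>2 * ?g 0" by (simp add: y_def power_mult_distrib numeral_2_eq_2)
    also have "?g 0 \<le> (\<Sum>q. ?g q)" using sum_le_suminf[OF s, of "{0}"] g0 by simp
    finally show ?thesis by (simp add: y_def mult_left_mono)
  qed
qed

lemma eigbasis_scale: "eigbasis A u a \<Longrightarrow> eigbasis (c *\<^sub>R A) u (\<lambda>i. c * a i)"
  by (simp add: eigbasis_def matrix_scaleR_mult_vec)

lemma mexp_quadratic_nonneg:
  assumes "symmetric_mat A"
  shows "0 \<le> v \<bullet> (mexp A *v v)"
proof -
  obtain u a where e: "eigbasis A u a" using assms by (rule symmetric_mat_eigbasis)
  show ?thesis unfolding eigbasis_inner_mult_vec[OF eigbasis_mexp[OF e]]
    by (intro sum_nonneg) (simp add: mult.assoc)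
qed

text \<open>In an eigenbasis of \<open>X\<close> both sides are sums over eigenvalues with weights
  \<open>(u i \<bullet> v)\<^sup>2\<close>, so the scalar inequality applies to each eigenvalue. The
  bound \<open>b\<close> is one-sided and may vary with \<open>X\<close>.\<close>

lemma mexp_le_quadratic:
  assumes s: "symmetric_mat X" and le: "\<And>w. w \<bullet> (X *v w) \<le> b * (w \<bullet> w)"
    and b: "0 \<le> b" and l: "0 \<le> l"
  shows "v \<bullet> (mexp (l *\<^sub>R X) *v v) \<le> v \<bullet> v + l * (v \<bullet> (X *v v))
    + (\<Sum>q. l ^ (q + 2) / fact (q + 2) * b ^ q) * (norm (X *v v))\<^sup>2"
proof -
  obtain u a where e: "eigbasis X u a" using s by (rule symmetric_mat_eigbasis)
  let ?\<phi> = "\<Sum>q. l ^ (q + 2) / fact (q + 2) * b ^ q"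
  have ab: "a i \<le> b" for i using le[of "u i"] by (simp add: eigbasisD[OF e])
  have "v \<bullet> (mexp (l *\<^sub>R X) *v v) = (\<Sum>i\<in>UNIV. exp (l * a i) * (u i \<bullet> v)\<^sup>2)"
    by (simp add: eigbasis_inner_mult_vec[OF eigbasis_mexp[OF eigbasis_scale[OF e]]]
        power2_eq_square mult.assoc)
  also have "\<dots> \<le> (\<Sum>i\<in>UNIV. (1 + l * a i + (a i)\<^sup>2 * ?\<phi>) * (u i \<bullet> v)\<^sup>2)"
    by (intro sum_mono mult_right_mono exp_le_quadratic ab b l) simp
  also have "(\<Sum>i\<in>UNIV. (1 + l * a i + (a i)\<^sup>2 * f) * (u i \<bullet> v)\<^sup>2)
      = v \<bullet> v + l * (v \<bullet> (X *v v)) + f * (norm (X *v v))\<^sup>2" for f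
  proof -
    have "v \<bullet> v = (\<Sum>i\<in>UNIV. (u i \<bullet> v)\<^sup>2)"
      by (simp add: eigbasis_inner[OF e, of v v] power2_eq_square)
    moreover have "v \<bullet> (X *v v) = (\<Sum>i\<in>UNIV. a i * (u i \<bullet> v)\<^sup>2)"
      by (simp add: eigbasis_inner_mult_vec[OF e] power2_eq_square mult.assoc)
    moreover have "(norm (X *v v))\<^sup>2 = (\<Sum>i\<in>UNIV. (a i)\<^sup>2 * (u i \<bullet> v)\<^sup>2)"
      unfolding power2_norm_eq_inner eigbasis_inner[OF e, of "X *v v" "X *v v"]
      by (simp add: eigbasis_mult_vec[OF e] power2_eq_square mult_ac)
    ultimately show ?thesis
      by (simp add: sum.distrib sum_distrib_left algebra_simps)
  qed
  finally show ?thesis .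
qed

section \<open>Laplace transforms of centred rank-one matrices\<close>

definition outer :: "real^'d \<Rightarrow> real^'d^'d" where
  "outer \<xi> = (\<chi> i j. \<xi> $ i * \<xi> $ j)"

lemma outer_mult_vec: "outer \<xi> *v v = (\<xi> \<bullet> v) *\<^sub>R \<xi>"
  by (simp add: outer_def matrix_vector_mult_def inner_vec_def vec_eq_iff sum_distrib_left mult_ac)

lemma symmetric_mat_outer: "symmetric_mat (outer \<xi>)"
  by (simp add: symmetric_mat_def outer_def transpose_def vec_eq_iff mult.commute)

lemma measurable_outer [measurable]: "outer \<in> borel_measurable borel"
proof (rule borel_measurable_continuous_onI)
  show "continuous_on UNIV (outer :: real^'d \<Rightarrow> real^'d^'d)"
    unfolding outer_def[abs_def] by (intro continuous_intros)
qed

lemma measurable_quadratic_form: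
  fixes v :: "real^'d"
  shows "(\<lambda>A. v \<bullet> (A *v v)) \<in> borel_measurable borel"
  unfolding inner_vec_def matrix_vector_mult_def
  by (intro borel_measurable_continuous_onI) (auto intro!: continuous_intros)

lemma measurable_quadratic_mexp:
  fixes v :: "real^'d" and Y :: "'b \<Rightarrow> real^'d^'d"
  assumes "Y \<in> borel_measurable M"
  shows "(\<lambda>x. v \<bullet> (mexp (Y x) *v v)) \<in> borel_measurable M"
  using measurable_compose[OF measurable_compose[OF assms measurable_mexp] measurable_quadratic_form] .

context
  fixes C :: "real^'d^'d"
  assumes sym: "symmetric_mat C" and psd: "pos_semidef C" and nz: "C \<noteq> 0"
begin

lemma integral_square_inner:
  "(\<integral>\<xi>. (\<xi> \<bullet> v)\<^sup>2 \<partial>mv_normal C) = v \<bullet> (C *v v)"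
  "integrable (mv_normal C) (\<lambda>\<xi>. (\<xi> \<bullet> v)\<^sup>2)"
proof -
  have eq: "(\<lambda>\<xi>. (\<xi> \<bullet> v)\<^sup>2) = (\<lambda>\<xi>. (v \<bullet> \<xi>) * ((v \<bullet> \<xi>) * (\<xi> \<bullet> \<xi>) ^ 0))"
    by (simp add: power2_eq_square inner_commute fun_eq_iff)
  show "(\<integral>\<xi>. (\<xi> \<bullet> v)\<^sup>2 \<partial>mv_normal C) = v \<bullet> (C *v v)"
    using mixed_moment_stein[OF sym psd, of 0 v v] unfolding eq mixed_moment_def by simp
  show "integrable (mv_normal C) (\<lambda>\<xi>. (\<xi> \<bullet> v)\<^sup>2)" unfolding eq by (rule integrable_mixed)
qed

text \<open>With \<open>b = \<xi> \<bullet> \<xi>\<close> the quadratic term becomes a series of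
  weighted square moments, whose factorials cancel against those of the exponential. Stated as a
  nonnegative integral, the estimate also yields finiteness of the transform.\<close>

lemma matrix_mgf_upper:
  fixes l :: real and v :: "real^'d"
  defines "r \<equiv> trace C / eigval 1 C" and "x \<equiv> l * eigval 1 C"
  assumes l: "0 \<le> l" and rx: "2 * r * x < 1"
  shows "(\<integral>\<^sup>+\<xi>. ennreal (v \<bullet> (mexp (l *\<^sub>R (outer \<xi> - C)) *v v)) \<partial>mv_normal C)
    \<le> ennreal ((1 + x\<^sup>2 * (r + 1) / (2 * (1 - 2 * r * x))) * (v \<bullet> v))"
proof -
  let ?N = "mv_normal C" and ?L = "eigval 1 C"
  let ?Q = "\<lambda>\<xi>. (norm ((\<xi> \<bullet> v) *\<^sub>R \<xi> - C *v v))\<^sup>2"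
  interpret prob_space ?N by (rule prob_space_mv_normal)
  have L: "0 < ?L" by (rule eigval_1_pos[OF sym psd nz])
  have r0: "0 \<le> r" unfolding r_def using L trace_nonneg[OF sym psd] by simp
  have x0: "0 \<le> x" using l L by (simp add: x_def)
  define g where "g q \<xi> = l ^ (q + 2) / fact (q + 2) * ((\<xi> \<bullet> \<xi>) ^ q * ?Q \<xi>)" for q \<xi>
  \<comment> \<open>Bound for the mean of \<open>g q\<close>: the powers of \<open>l\<close> and of
    \<open>?L\<close> combine into powers of \<open>x\<close>, leaving a geometric sequence of ratio
    \<open>2 * r * x\<close>.\<close>
  define h where "h q = (x\<^sup>2 * (r + 1) / 2 * (v \<bullet> v)) * (2 * r * x) ^ q" for q :: nat
  have g0: "0 \<le> g q \<xi>" for q \<xi> unfolding g_def using l by simp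
  have gint: "integrable ?N (g q)" for q
    unfolding g_def by (intro integrable_mult_right weighted_square_moment sym psd)
  have gle: "(\<integral>\<xi>. g q \<xi> \<partial>?N) \<le> h q" for q
  proof -
    have "(\<integral>\<xi>. g q \<xi> \<partial>?N) = l ^ (q + 2) / fact (q + 2) * (\<integral>\<xi>. (\<xi> \<bullet> \<xi>) ^ q * ?Q \<xi> \<partial>?N)"
      unfolding g_def by (rule integral_mult_right_zero)
    also have "\<dots> \<le> l ^ (q + 2) / fact (q + 2)
        * (fact (q + 2) / 2 * (2 * r) ^ q * (r + 1) * ?L ^ (q + 2) * (v \<bullet> v))"
      unfolding r_def using l by (intro mult_left_mono weighted_square_moment_le sym psd L) simp
    also have "\<dots> = (l ^ (q + 2) * ?L ^ (q + 2)) / 2 * (2 * r) ^ q * (r + 1) * (v \<bullet> v)"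
      by (simp del: fact_Suc add: field_simps)
    also have "\<dots> = h q"
      unfolding h_def x_def power_mult_distrib[symmetric]
      by (simp add: power_add power_mult_distrib power2_eq_square mult_ac)
    finally show ?thesis .
  qed
  have hs: "h sums ((x\<^sup>2 * (r + 1) / 2 * (v \<bullet> v)) * (1 / (1 - 2 * r * x)))"
    unfolding h_def using rx r0 x0 by (intro sums_mult geometric_sums) simp
  have gsum: "summable (\<lambda>q. g q \<xi>)"
    and gval: "(\<Sum>q. g q \<xi>) = (\<Sum>q. l ^ (q + 2) / fact (q + 2) * (\<xi> \<bullet> \<xi>) ^ q) * ?Q \<xi>" for \<xi>
  proof -
    have s: "summable (\<lambda>q. l ^ (q + 2) / fact (q + 2) * (\<xi> \<bullet> \<xi>) ^ q)"
      by (rule exp_le_quadratic(1)[OF order_refl _ l]) simp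
    have eq: "(\<lambda>q. g q \<xi>) = (\<lambda>q. (l ^ (q + 2) / fact (q + 2) * (\<xi> \<bullet> \<xi>) ^ q) * ?Q \<xi>)"
      unfolding g_def by (simp only: mult.assoc)
    show "summable (\<lambda>q. g q \<xi>)" unfolding eq by (rule summable_mult2[OF s])
    show "(\<Sum>q. g q \<xi>) = (\<Sum>q. l ^ (q + 2) / fact (q + 2) * (\<xi> \<bullet> \<xi>) ^ q) * ?Q \<xi>"
      unfolding eq by (rule suminf_mult2[OF s, symmetric])
  qed
  \<comment> \<open>Summability of the means is what justifies exchanging the series with the
    integral.\<close>
  have nsum: "summable (\<lambda>q. \<integral>\<xi>. norm (g q \<xi>) \<partial>?N)"
    by (rule summable_comparison_test[OF _ sums_summable[OF hs]])
      (use gle g0 in \<open>auto simp: Bochner_Integration.integral_nonneg\<close>)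
  have asum: "AE \<xi> in ?N. summable (\<lambda>q. norm (g q \<xi>))" using gsum g0 by simp
  have Gint: "integrable ?N (\<lambda>\<xi>. \<Sum>q. g q \<xi>)" by (rule integrable_suminf[OF gint asum nsum])
  have "(\<integral>\<xi>. (\<Sum>q. g q \<xi>) \<partial>?N) = (\<Sum>q. \<integral>\<xi>. g q \<xi> \<partial>?N)" by (rule integral_suminf[OF gint asum nsum])
  also have "\<dots> \<le> (\<Sum>q. h q)"
    using nsum g0 by (intro suminf_le gle sums_summable[OF hs]) simp
  finally have G: "(\<integral>\<xi>. (\<Sum>q. g q \<xi>) \<partial>?N) \<le> (x\<^sup>2 * (r + 1) / 2 * (v \<bullet> v)) * (1 / (1 - 2 * r * x))"
    using sums_unique[OF hs] by simp
  \<comment> \<open>The part of the expansion up to first order in \<open>l\<close>; it has mean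
    \<open>v \<bullet> v\<close> because the rank-one matrix minus \<open>C\<close> is
    centred.\<close>
  define P where "P \<xi> = v \<bullet> v + l * ((\<xi> \<bullet> v)\<^sup>2 - v \<bullet> (C *v v))" for \<xi>
  have Pint: "integrable ?N P" unfolding P_def
    by (intro Bochner_Integration.integrable_add integrable_mult_right Bochner_Integration.integrable_diff
        integral_square_inner integrable_const)
  have Pval: "(\<integral>\<xi>. P \<xi> \<partial>?N) = v \<bullet> v" unfolding P_def
    by (simp add: integral_square_inner prob_space[simplified])
  have tot: "(\<integral>\<xi>. P \<xi> + (\<Sum>q. g q \<xi>) \<partial>?N)
      \<le> (1 + x\<^sup>2 * (r + 1) / (2 * (1 - 2 * r * x))) * (v \<bullet> v)"
  proof -
    have "(x\<^sup>2 * (r + 1) / 2 * (v \<bullet> v)) * (1 / (1 - 2 * r * x))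
        = x\<^sup>2 * (r + 1) / (2 * (1 - 2 * r * x)) * (v \<bullet> v)" by simp
    then show ?thesis
      using G unfolding Bochner_Integration.integral_add[OF Pint Gint] Pval distrib_right by simp
  qed
  have le: "v \<bullet> (mexp (l *\<^sub>R (outer \<xi> - C)) *v v) \<le> P \<xi> + (\<Sum>q. g q \<xi>)" for \<xi>
  proof -
    have mv: "(outer \<xi> - C) *v w = (\<xi> \<bullet> w) *\<^sub>R \<xi> - C *v w" for w
      by (simp add: matrix_vector_mult_diff_rdistrib outer_mult_vec)
    have "w \<bullet> ((outer \<xi> - C) *v w) \<le> (\<xi> \<bullet> \<xi>) * (w \<bullet> w)" for w
    proof -
      have "w \<bullet> ((outer \<xi> - C) *v w) = (\<xi> \<bullet> w)\<^sup>2 - w \<bullet> (C *v w)"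
        unfolding mv by (simp add: inner_diff_right power2_eq_square inner_commute)
      also have "\<dots> \<le> (\<xi> \<bullet> w)\<^sup>2" using psd by (simp add: pos_semidef_def)
      also have "\<dots> \<le> (\<xi> \<bullet> \<xi>) * (w \<bullet> w)" by (rule Cauchy_Schwarz_ineq)
      finally show ?thesis .
    qed
    from mexp_le_quadratic[OF symmetric_mat_combine(2)[OF symmetric_mat_outer sym] this _ l, of v]
    show ?thesis unfolding gval P_def mv
      by (simp add: inner_diff_right power2_eq_square inner_commute)
  qed
  have nn: "0 \<le> v \<bullet> (mexp (l *\<^sub>R (outer \<xi> - C)) *v v)" for \<xi>
    by (intro mexp_quadratic_nonneg symmetric_mat_combine symmetric_mat_outer sym)
  have "(\<integral>\<^sup>+\<xi>. ennreal (v \<bullet> (mexp (l *\<^sub>R (outer \<xi> - C)) *v v)) \<partial>?N)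
      \<le> (\<integral>\<^sup>+\<xi>. ennreal (P \<xi> + (\<Sum>q. g q \<xi>)) \<partial>?N)"
    by (intro nn_integral_mono ennreal_leI le)
  also have "\<dots> = ennreal (\<integral>\<xi>. P \<xi> + (\<Sum>q. g q \<xi>) \<partial>?N)"
    using order_trans[OF nn le]
    by (intro nn_integral_eq_integral Bochner_Integration.integrable_add Pint Gint AE_I2)
  also have "\<dots> \<le> ennreal ((1 + x\<^sup>2 * (r + 1) / (2 * (1 - 2 * r * x))) * (v \<bullet> v))"
    by (rule ennreal_leI[OF tot])
  finally show ?thesis .
qed

text \<open>Here the bound \<open>b = ?L\<close> is deterministic, so the coefficient
  \<open>\<phi>\<close> is a constant and only the unweighted square moment enters. The estimate is
  then relaxed to the form of the upper tail, so that both tails share one exponent.\<close>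

lemma matrix_mgf_lower:
  fixes l :: real and v :: "real^'d"
  defines "r \<equiv> trace C / eigval 1 C" and "x \<equiv> l * eigval 1 C"
  assumes l: "0 \<le> l" and rx: "2 * r * x < 1"
  shows "(\<integral>\<^sup>+\<xi>. ennreal (v \<bullet> (mexp (l *\<^sub>R (C - outer \<xi>)) *v v)) \<partial>mv_normal C)
    \<le> ennreal ((1 + x\<^sup>2 * (r + 1) / (2 * (1 - 2 * r * x))) * (v \<bullet> v))"
proof -
  let ?N = "mv_normal C" and ?L = "eigval 1 C"
  let ?Q = "\<lambda>\<xi>. (norm ((\<xi> \<bullet> v) *\<^sub>R \<xi> - C *v v))\<^sup>2"
  interpret prob_space ?N by (rule prob_space_mv_normal)
  have L: "0 < ?L" by (rule eigval_1_pos[OF sym psd nz])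
  have r1: "1 \<le> r" unfolding r_def using L eigval_1_le_trace[OF sym psd] by simp
  have x0: "0 \<le> x" using l L by (simp add: x_def)
  define \<phi> where "\<phi> = (\<Sum>q. l ^ (q + 2) / fact (q + 2) * ?L ^ q)"
  have \<phi>s: "summable (\<lambda>q. l ^ (q + 2) / fact (q + 2) * ?L ^ q)"
    by (rule exp_le_quadratic(1)[OF order_refl _ l]) (use L in simp)
  have \<phi>0: "0 \<le> \<phi>" unfolding \<phi>_def using l L by (intro suminf_nonneg \<phi>s) simp
  \<comment> \<open>\<open>\<phi> * ?L\<^sup>2\<close> is exp x - 1 - x. It is dominated termwise by
    the geometric series through \<open>fact (q + 2) \<ge> 2\<close> and
    \<open>x \<le> 2 * r * x\<close>, the latter by \<open>1 \<le> r\<close>.\<close>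
  have \<phi>le: "\<phi> * ?L\<^sup>2 \<le> x\<^sup>2 / (2 * (1 - 2 * r * x))"
  proof -
    have hs: "(\<lambda>q. (x\<^sup>2 / 2) * (2 * r * x) ^ q) sums ((x\<^sup>2 / 2) * (1 / (1 - 2 * r * x)))"
      using rx r1 x0 by (intro sums_mult geometric_sums) simp
    have "\<phi> * ?L\<^sup>2 = (\<Sum>q. l ^ (q + 2) / fact (q + 2) * ?L ^ q * ?L\<^sup>2)"
      unfolding \<phi>_def by (rule suminf_mult2[OF \<phi>s])
    also have "\<dots> \<le> (\<Sum>q. (x\<^sup>2 / 2) * (2 * r * x) ^ q)"
    proof (rule suminf_le[OF _ summable_mult2[OF \<phi>s] sums_summable[OF hs]])
      fix q
      have "l ^ (q + 2) / fact (q + 2) * ?L ^ q * ?L\<^sup>2 = x ^ (q + 2) * (1 / fact (q + 2))"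
        by (simp add: x_def power_mult_distrib power_add power2_eq_square mult_ac)
      also have "\<dots> \<le> x ^ (q + 2) * (1 / 2)"
      proof (intro mult_left_mono)
        have "fact 2 \<le> (fact (q + 2) :: real)" by (rule fact_mono) simp
        then show "1 / fact (q + 2) \<le> (1 / 2 :: real)" by (intro divide_left_mono) (auto simp: numeral_2_eq_2)
      qed (use x0 in simp)
      also have "\<dots> = (x\<^sup>2 / 2) * x ^ q" by (simp add: power_add power2_eq_square mult_ac)
      also have "\<dots> \<le> (x\<^sup>2 / 2) * (2 * r * x) ^ q"
      proof (intro mult_left_mono power_mono)
        have "1 * x \<le> (2 * r) * x" using r1 x0 by (intro mult_right_mono) auto
        then show "x \<le> 2 * r * x" by simp
      qed (use x0 in auto)
      finally show "l ^ (q + 2) / fact (q + 2) * ?L ^ q * ?L\<^sup>2 \<le> (x\<^sup>2 / 2) * (2 * r * x) ^ q" .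
    qed
    also have "\<dots> = x\<^sup>2 / (2 * (1 - 2 * r * x))" using sums_unique[OF hs] by simp
    finally show ?thesis .
  qed
  have Qint: "integrable ?N ?Q" using weighted_square_moment(2)[OF sym psd, of 0 v] by simp
  have Q: "(\<integral>\<xi>. ?Q \<xi> \<partial>?N) \<le> (r + 1) * ?L\<^sup>2 * (v \<bullet> v)"
    using weighted_square_moment_le[OF sym psd L, of 0 v] by (simp add: r_def numeral_2_eq_2)
  define P where "P \<xi> = v \<bullet> v + l * (v \<bullet> (C *v v) - (\<xi> \<bullet> v)\<^sup>2)" for \<xi>
  have Pint: "integrable ?N P" unfolding P_def
    by (intro Bochner_Integration.integrable_add integrable_mult_right Bochner_Integration.integrable_diff
        integral_square_inner integrable_const)
  have Pval: "(\<integral>\<xi>. P \<xi> \<partial>?N) = v \<bullet> v" unfolding P_def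
    by (simp add: integral_square_inner prob_space[simplified])
  have Gint: "integrable ?N (\<lambda>\<xi>. \<phi> * ?Q \<xi>)" by (intro integrable_mult_right Qint)
  have "\<phi> * (\<integral>\<xi>. ?Q \<xi> \<partial>?N) \<le> \<phi> * ((r + 1) * ?L\<^sup>2 * (v \<bullet> v))"
    by (rule mult_left_mono[OF Q \<phi>0])
  also have "\<dots> = (\<phi> * ?L\<^sup>2) * ((r + 1) * (v \<bullet> v))" by (simp add: mult_ac)
  also have "\<dots> \<le> x\<^sup>2 / (2 * (1 - 2 * r * x)) * ((r + 1) * (v \<bullet> v))"
    using r1 by (intro mult_right_mono \<phi>le) auto
  finally have tot: "(\<integral>\<xi>. P \<xi> + \<phi> * ?Q \<xi> \<partial>?N)
      \<le> (1 + x\<^sup>2 * (r + 1) / (2 * (1 - 2 * r * x))) * (v \<bullet> v)"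
    by (simp add: Bochner_Integration.integral_add[OF Pint Gint] Pval algebra_simps)
  have le: "v \<bullet> (mexp (l *\<^sub>R (C - outer \<xi>)) *v v) \<le> P \<xi> + \<phi> * ?Q \<xi>" for \<xi>
  proof -
    have mv: "(C - outer \<xi>) *v w = C *v w - (\<xi> \<bullet> w) *\<^sub>R \<xi>" for w
      by (simp add: matrix_vector_mult_diff_rdistrib outer_mult_vec)
    have "w \<bullet> ((C - outer \<xi>) *v w) \<le> ?L * (w \<bullet> w)" for w
    proof -
      have "w \<bullet> ((C - outer \<xi>) *v w) = w \<bullet> (C *v w) - (\<xi> \<bullet> w)\<^sup>2"
        unfolding mv by (simp add: inner_diff_right power2_eq_square inner_commute)
      also have "\<dots> \<le> w \<bullet> (C *v w)" by simp
      also have "\<dots> \<le> ?L * (w \<bullet> w)" by (rule eigval_1_ge[OF sym])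
      finally show ?thesis .
    qed
    from mexp_le_quadratic[OF symmetric_mat_combine(2)[OF sym symmetric_mat_outer] this _ l, of v]
    show ?thesis unfolding \<phi>_def P_def mv using L
      by (simp add: inner_diff_right power2_eq_square inner_commute norm_minus_commute)
  qed
  have nn: "0 \<le> v \<bullet> (mexp (l *\<^sub>R (C - outer \<xi>)) *v v)" for \<xi>
    by (intro mexp_quadratic_nonneg symmetric_mat_combine symmetric_mat_outer sym)
  have "(\<integral>\<^sup>+\<xi>. ennreal (v \<bullet> (mexp (l *\<^sub>R (C - outer \<xi>)) *v v)) \<partial>?N)
      \<le> (\<integral>\<^sup>+\<xi>. ennreal (P \<xi> + \<phi> * ?Q \<xi>) \<partial>?N)"
    by (intro nn_integral_mono ennreal_leI le)
  also have "\<dots> = ennreal (\<integral>\<xi>. P \<xi> + \<phi> * ?Q \<xi> \<partial>?N)"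
    using order_trans[OF nn le]
    by (intro nn_integral_eq_integral Bochner_Integration.integrable_add Pint Gint AE_I2)
  also have "\<dots> \<le> ennreal ((1 + x\<^sup>2 * (r + 1) / (2 * (1 - 2 * r * x))) * (v \<bullet> v))"
    by (rule ennreal_leI[OF tot])
  finally show ?thesis .
qed

end

section \<open>Deviation bounds\<close>

text \<open>Ahlswede and Winter: Golden-Thompson lets one factor be integrated out at a time.\<close>
lemma trace_mexp_sum_le:
  fixes Y :: "real^'d \<Rightarrow> real^'d^'d" and N :: "(real^'d) measure"
  assumes N: "prob_space N" and Y [measurable]: "Y \<in> borel_measurable N"
    and sym: "\<And>\<xi>. symmetric_mat (Y \<xi>)" and \<beta>: "0 \<le> \<beta>"
    and mgf: "\<And>v. (\<integral>\<^sup>+\<xi>. ennreal (v \<bullet> (mexp (Y \<xi>) *v v)) \<partial>N) \<le> ennreal (\<beta> * (v \<bullet> v))"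
    and I: "finite (I :: nat set)"
  shows "(\<integral>\<^sup>+\<xi>. ennreal (trace (mexp (\<Sum>k\<in>I. Y (\<xi> k)))) \<partial>(\<Pi>\<^sub>M k\<in>I. N)) \<le> ennreal (real CARD('d) * \<beta> ^ card I)"
  using I
proof (induction I)
  case empty
  have "symmetric_mat (0 :: real^'d^'d)" by (simp add: symmetric_mat_def transpose_def vec_eq_iff)
  then obtain u a where e: "eigbasis (0 :: real^'d^'d) u a" by (rule symmetric_mat_eigbasis)
  have "a i = 0" for i using eigbasisD[OF e] by simp
  \<comment> \<open>The dimension factor enters here, as the trace of the identity; the induction
    step only multiplies by \<open>\<beta>\<close>.\<close>
  then have "trace (mexp (0 :: real^'d^'d)) = real CARD('d)"
    unfolding eigbasis_trace[OF e] by (simp add: eigbasisD[OF eigbasis_mexp[OF e]])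
  then show ?case by (simp add: PiM_empty nn_integral_count_space_finite)
next
  case (insert i I)
  interpret product_sigma_finite "\<lambda>_::nat. N"
    by (intro product_sigma_finite.intro prob_space_imp_sigma_finite N)
  let ?S = "\<lambda>J \<xi>. \<Sum>k\<in>J. Y (\<xi> k)"
  have symS: "symmetric_mat (?S J \<xi>)" for J and \<xi> :: "nat \<Rightarrow> real^'d"
  proof (induction J rule: infinite_finite_induct)
    case (insert x F)
    then show ?case using symmetric_mat_combine(1)[OF sym] by simp
  qed (simp_all add: symmetric_mat_def transpose_def vec_eq_iff)
  have m: "(\<lambda>\<xi>. ennreal (trace (mexp (?S J \<xi>)))) \<in> borel_measurable (\<Pi>\<^sub>M k\<in>J. N)" for J
  proof -
    have "(\<lambda>\<xi>. ?S J \<xi>) \<in> borel_measurable (\<Pi>\<^sub>M k\<in>J. N)"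
      by (intro borel_measurable_sum measurable_compose[OF measurable_component_singleton[of _ J "\<lambda>_. N"] Y])
    then show ?thesis by measurable
  qed
  \<comment> \<open>Golden-Thompson separates the fixed \<open>A\<close> from the random
    \<open>Y \<eta>\<close>. In an eigenbasis of \<open>A\<close> the trace is a combination, with
    positive weights \<open>exp (a j)\<close>, of quadratic forms at fixed vectors, and
    \<open>mgf\<close> bounds each of them.\<close>
  have step: "(\<integral>\<^sup>+\<eta>. ennreal (trace (mexp (A + Y \<eta>))) \<partial>N) \<le> ennreal \<beta> * ennreal (trace (mexp A))"
    if A: "symmetric_mat A" for A
  proof -
    obtain u a where e: "eigbasis A u a" using A by (rule symmetric_mat_eigbasis)
    note ee = eigbasis_mexp[OF e]
    have q: "0 \<le> v \<bullet> (mexp (Y \<eta>) *v v)" for v \<eta> by (rule mexp_quadratic_nonneg[OF sym])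
    have tr: "trace (mexp A ** mexp (Y \<eta>)) = (\<Sum>j\<in>UNIV. exp (a j) * (u j \<bullet> (mexp (Y \<eta>) *v u j)))" for \<eta>
      unfolding eigbasis_trace[OF e]
      by (simp add: matrix_vector_mul_assoc[symmetric] eigbasis_mult_vec[OF ee])
    have "(\<integral>\<^sup>+\<eta>. ennreal (trace (mexp (A + Y \<eta>))) \<partial>N)
        \<le> (\<integral>\<^sup>+\<eta>. (\<Sum>j\<in>UNIV. ennreal (exp (a j)) * ennreal (u j \<bullet> (mexp (Y \<eta>) *v u j))) \<partial>N)"
    proof (rule nn_integral_mono)
      fix \<eta>
      have "trace (mexp (A + Y \<eta>)) \<le> (\<Sum>j\<in>UNIV. exp (a j) * (u j \<bullet> (mexp (Y \<eta>) *v u j)))"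
        using golden_thompson[OF A sym] tr by simp
      then have "ennreal (trace (mexp (A + Y \<eta>)))
          \<le> ennreal (\<Sum>j\<in>UNIV. exp (a j) * (u j \<bullet> (mexp (Y \<eta>) *v u j)))" by (rule ennreal_leI)
      also have "\<dots> = (\<Sum>j\<in>UNIV. ennreal (exp (a j) * (u j \<bullet> (mexp (Y \<eta>) *v u j))))"
        using q by (subst sum_ennreal) auto
      also have "\<dots> = (\<Sum>j\<in>UNIV. ennreal (exp (a j)) * ennreal (u j \<bullet> (mexp (Y \<eta>) *v u j)))"
        using q by (intro sum.cong refl ennreal_mult) auto
      finally show "ennreal (trace (mexp (A + Y \<eta>)))
          \<le> (\<Sum>j\<in>UNIV. ennreal (exp (a j)) * ennreal (u j \<bullet> (mexp (Y \<eta>) *v u j)))" .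
    qed
    also have "\<dots> = (\<Sum>j\<in>UNIV. ennreal (exp (a j)) * (\<integral>\<^sup>+\<eta>. ennreal (u j \<bullet> (mexp (Y \<eta>) *v u j)) \<partial>N))"
      using measurable_quadratic_mexp[OF Y] by (simp add: nn_integral_sum nn_integral_cmult)
    also have "\<dots> \<le> (\<Sum>j\<in>UNIV. ennreal (exp (a j)) * ennreal \<beta>)"
    proof (intro sum_mono mult_left_mono)
      show "(\<integral>\<^sup>+\<eta>. ennreal (u j \<bullet> (mexp (Y \<eta>) *v u j)) \<partial>N) \<le> ennreal \<beta>" for j
        using mgf[of "u j"] by (simp add: eigbasisD(1)[OF e])
    qed simp
    also have "\<dots> = ennreal \<beta> * ennreal (\<Sum>j\<in>UNIV. exp (a j))"
      by (simp add: sum_distrib_left mult.commute flip: sum_ennreal)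
    also have "(\<Sum>j\<in>UNIV. exp (a j)) = trace (mexp A)"
      unfolding eigbasis_trace[OF e] by (simp add: eigbasisD[OF ee])
    finally show ?thesis .
  qed
  have "(\<integral>\<^sup>+\<xi>. ennreal (trace (mexp (?S (insert i I) \<xi>))) \<partial>(\<Pi>\<^sub>M k\<in>insert i I. N))
      = (\<integral>\<^sup>+\<xi>. \<integral>\<^sup>+\<eta>. ennreal (trace (mexp (?S (insert i I) (\<xi>(i := \<eta>))))) \<partial>N \<partial>(\<Pi>\<^sub>M k\<in>I. N))"
    by (rule product_nn_integral_insert[OF insert.hyps m])
  also have "\<dots> = (\<integral>\<^sup>+\<xi>. \<integral>\<^sup>+\<eta>. ennreal (trace (mexp (?S I \<xi> + Y \<eta>))) \<partial>N \<partial>(\<Pi>\<^sub>M k\<in>I. N))"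
  proof -
    have "?S (insert i I) (\<xi>(i := \<eta>)) = ?S I \<xi> + Y \<eta>" for \<xi> \<eta>
    proof -
      have "?S I (\<xi>(i := \<eta>)) = ?S I \<xi>" using insert.hyps by (intro sum.cong) auto
      then show ?thesis using insert.hyps by (simp add: add.commute)
    qed
    then show ?thesis by simp
  qed
  also have "\<dots> \<le> (\<integral>\<^sup>+\<xi>. ennreal \<beta> * ennreal (trace (mexp (?S I \<xi>))) \<partial>(\<Pi>\<^sub>M k\<in>I. N))"
    by (intro nn_integral_mono step symS)
  also have "\<dots> = ennreal \<beta> * (\<integral>\<^sup>+\<xi>. ennreal (trace (mexp (?S I \<xi>))) \<partial>(\<Pi>\<^sub>M k\<in>I. N))"
    by (rule nn_integral_cmult[OF m])
  also have "\<dots> \<le> ennreal \<beta> * ennreal (real CARD('d) * \<beta> ^ card I)"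
    by (intro mult_left_mono insert.IH) simp
  also have "\<dots> = ennreal (real CARD('d) * \<beta> ^ card (insert i I))"
    using insert.hyps \<beta> by (simp add: ennreal_mult[symmetric] mult_ac)
  finally show ?case .
qed

section \<open>Chernoff bound for the Wishart law\<close>

lemma scatter_matrix_eq: "scatter_matrix n \<xi> = (\<Sum>k<n. outer (\<xi> k))"
  by (simp add: scatter_matrix_def outer_def)

lemma measurable_scatter_matrix:
  "scatter_matrix n \<in> borel_measurable (\<Pi>\<^sub>M k\<in>{..<n}. mv_normal C)"
proof -
  have o: "outer \<in> borel_measurable (mv_normal C)"
    unfolding measurable_cong_sets[OF sets_mv_normal refl] by (rule measurable_outer)
  show ?thesis unfolding scatter_matrix_eq[abs_def]
    by (intro borel_measurable_sum
        measurable_compose[OF measurable_component_singleton[of _ "{..<n}" "\<lambda>_. mv_normal C"] o])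
qed

text \<open>\<open>S\<close> is specified only through its law, so symmetry of its values is an
  almost sure statement. Symmetric matrices form a closed, hence Borel, set that contains every
  scatter matrix.\<close>

lemma AE_wishart_symmetric: "AE X in wishart n C. symmetric_mat X" for C :: "real^'d^'d"
proof -
  have "closed {X :: real^'d^'d. \<forall>i j. X $ j $ i = X $ i $ j}"
    by (intro closed_Collect_all closed_Collect_eq continuous_intros)
  then have s: "{X \<in> space borel. symmetric_mat X} \<in> sets (borel :: (real^'d^'d) measure)"
    using borel_closed by (simp add: symmetric_mat_def transpose_def vec_eq_iff)
  have "symmetric_mat (scatter_matrix n \<xi>)" for \<xi> :: "nat \<Rightarrow> real^'d"
    by (simp add: symmetric_mat_def scatter_matrix_def transpose_def vec_eq_iff mult.commute)
  then show ?thesis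
    unfolding wishart_def AE_distr_iff[OF measurable_scatter_matrix s] by simp
qed

text \<open>The trace of the exponential is a sum of positive terms, one of which comes from the top
  eigenvalue.\<close>

lemma exp_le_trace_mexp:
  assumes s: "symmetric_mat A" and c: "0 \<le> c" and t: "t \<le> eigval 1 A"
  shows "exp (c * t) \<le> trace (mexp (c *\<^sub>R A))"
proof -
  obtain u a where e: "eigbasis A u a" using s by (rule symmetric_mat_eigbasis)
  obtain i where i: "eigval 1 A = a i" using eigval_1_attained[OF e] .
  note ee = eigbasis_mexp[OF eigbasis_scale[OF e]]
  have "exp (c * t) \<le> exp (c * a i)" using t c i by (simp add: mult_left_mono)
  also have "\<dots> \<le> (\<Sum>j\<in>UNIV. exp (c * a j))" by (rule member_le_sum) auto
  also have "\<dots> = trace (mexp (c *\<^sub>R A))"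
    unfolding eigbasis_trace[OF ee] by (simp add: eigbasisD[OF ee])
  finally show ?thesis .
qed

text \<open>The choice of \<open>x\<close> is the minimiser of the Bernstein exponent.\<close>
lemma bernstein_exponent:
  fixes \<theta> r :: real and n :: nat
  assumes "0 \<le> \<theta>" "0 < r" "1 \<le> n"
  obtains x where "0 \<le> x" "2 * r * x < 1"
    "real n * (x\<^sup>2 * (r + 1) / (2 * (1 - 2 * r * x)))
      - x * real n * (sqrt (2 * \<theta> * (r + 1) / real n) + 2 * \<theta> * r / real n) = - \<theta>"
proof -
  \<comment> \<open>\<open>s\<close> removes the root:
    \<open>\<theta> = real n * (r + 1) * s\<^sup>2 / 2\<close>, and the threshold becomes
    \<open>(r + 1) * s + r * (r + 1) * s\<^sup>2\<close>.\<close>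
  define s where "s = sqrt (2 * \<theta> / (real n * (r + 1)))"
  define x where "x = s / (1 + 2 * r * s)"
  have n: "0 < real n" using assms by simp
  have s0: "0 \<le> s" using assms by (simp add: s_def)
  have d: "0 < 1 + 2 * r * s" using s0 assms by (simp add: add_pos_nonneg)
  have s2: "s\<^sup>2 = 2 * \<theta> / (real n * (r + 1))" using assms by (simp add: s_def)
  have th: "\<theta> = real n * (r + 1) * s\<^sup>2 / 2" unfolding s2 using assms n by simp
  have sq: "sqrt (2 * \<theta> * (r + 1) / real n) = (r + 1) * s"
  proof (rule real_sqrt_unique)
    show "((r + 1) * s)\<^sup>2 = 2 * \<theta> * (r + 1) / real n"
      unfolding power_mult_distrib s2 using assms n by (simp add: power2_eq_square)
  qed (use s0 assms in simp)
  have t2: "2 * \<theta> * r / real n = r * (r + 1) * s\<^sup>2" unfolding th using n by simp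
  have x: "0 \<le> x" using s0 d by (simp add: x_def)
  have one: "1 - 2 * r * x = 1 / (1 + 2 * r * s)" unfolding x_def using d by (simp add: field_simps)
  then have lt: "2 * r * x < 1" using d by (smt (verit) divide_pos_pos)
  have A: "x\<^sup>2 * (r + 1) / (2 * (1 - 2 * r * x)) = s\<^sup>2 * (r + 1) / (2 * (1 + 2 * r * s))"
    unfolding one using d by (simp add: x_def power2_eq_square)
  have "real n * (x\<^sup>2 * (r + 1) / (2 * (1 - 2 * r * x)))
      - x * real n * (sqrt (2 * \<theta> * (r + 1) / real n) + 2 * \<theta> * r / real n)
    = real n * (s\<^sup>2 * (r + 1) / (2 * (1 + 2 * r * s)))
      - s / (1 + 2 * r * s) * real n * ((r + 1) * s + r * (r + 1) * s\<^sup>2)"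
    unfolding A sq t2 by (simp add: x_def)
  also have "\<dots> = (real n * (s\<^sup>2 * (r + 1)) / 2
      - s * real n * ((r + 1) * s + r * (r + 1) * s\<^sup>2)) / (1 + 2 * r * s)"
  proof -
    have "n' * (p / (2 * d)) - s / d * n' * q = (n' * p / 2 - s * n' * q) / d" for n' p d q :: real
      by (simp add: diff_divide_distrib)
    then show ?thesis .
  qed
  \<comment> \<open>The numerator contains the factor \<open>1 + 2 * r * s\<close>, so the division
    is exact and the threshold needs no extra slack.\<close>
  also have "\<dots> = - (real n * (r + 1) * s\<^sup>2 / 2) * (1 + 2 * r * s) / (1 + 2 * r * s)"
    by (rule arg_cong[where f="\<lambda>z. z / (1 + 2 * r * s)"]) (simp add: power2_eq_square field_simps)
  also have "\<dots> = - \<theta>" unfolding th using d by (intro nonzero_mult_div_cancel_right) simp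
  finally show ?thesis using that x lt by blast
qed

text \<open>The sign \<open>\<sigma>\<close> treats both tails at once. The conclusion provides a
  measurable set \<open>B\<close> covering the deviation event almost surely: the event is expressed
  by \<open>eigval\<close>, whereas \<open>B\<close> is expressed by the trace of
  \<open>mexp\<close>, which is known to be measurable.\<close>

lemma wishart_one_sided_deviation:
  fixes M :: "'w measure" and S :: "'w \<Rightarrow> real^'d^'d" and C :: "real^'d^'d" and \<theta> \<sigma> :: real
  assumes M: "prob_space M" and n: "1 \<le> n"
    and C: "symmetric_mat C" "pos_semidef C" "C \<noteq> 0"
    and S: "S \<in> borel_measurable M" "distr M borel S = wishart n C"
    and \<theta>: "0 \<le> \<theta>" and \<sigma>: "\<sigma> = 1 \<or> \<sigma> = -1"
  defines "r \<equiv> trace C / eigval 1 C"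
  obtains B where "B \<in> sets M" "measure M B \<le> real CARD('d) * exp (- \<theta>)"
    "AE \<omega> in M. (sqrt (2 * \<theta> * (r + 1) / real n) + 2 * \<theta> * r / real n) * eigval 1 C
      \<le> eigval 1 (\<sigma> *\<^sub>R ((1 / real n) *\<^sub>R S \<omega> - C)) \<longrightarrow> \<omega> \<in> B"
proof -
  interpret prob_space M by (rule M)
  let ?N = "mv_normal C"
  define L where "L = eigval 1 C"
  have L: "0 < L" unfolding L_def by (rule eigval_1_pos[OF C])
  have r1: "1 \<le> r" unfolding r_def using L eigval_1_le_trace[OF C(1,2)] by (simp add: L_def)
  define t where "t = sqrt (2 * \<theta> * (r + 1) / real n) + 2 * \<theta> * r / real n"
  obtain x where x: "0 \<le> x" "2 * r * x < 1"
    and ex: "real n * (x\<^sup>2 * (r + 1) / (2 * (1 - 2 * r * x))) - x * real n * t = - \<theta>"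
    using bernstein_exponent[OF \<theta> _ n, of r] r1 unfolding t_def by auto
  \<comment> \<open>\<open>x\<close> is the scale-free parameter of the optimisation; dividing by
    \<open>L\<close> returns to the parameter of the Laplace transform.\<close>
  define l where "l = x / L"
  define K where "K = x\<^sup>2 * (r + 1) / (2 * (1 - 2 * r * x))"
  have l: "0 \<le> l" "l * eigval 1 C = x" using x L by (auto simp: l_def L_def)
  have K: "0 \<le> K" unfolding K_def using x r1 by simp
  define Y where "Y \<xi> = l *\<^sub>R (\<sigma> *\<^sub>R (outer \<xi> - C))" for \<xi>
  have symY: "symmetric_mat (Y \<xi>)" for \<xi>
    unfolding Y_def by (intro symmetric_mat_combine symmetric_mat_outer C)
  have mgf: "(\<integral>\<^sup>+\<xi>. ennreal (v \<bullet> (mexp (Y \<xi>) *v v)) \<partial>?N) \<le> ennreal ((1 + K) * (v \<bullet> v))" for v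
    using \<sigma>
  proof
    assume "\<sigma> = 1"
    then show ?thesis unfolding Y_def K_def
      using matrix_mgf_upper[OF C l(1), of v] x(2) unfolding l(2) r_def by simp
  next
    assume "\<sigma> = -1"
    then have "Y \<xi> = l *\<^sub>R (C - outer \<xi>)" for \<xi> by (simp add: Y_def)
    then show ?thesis unfolding K_def
      using matrix_mgf_lower[OF C l(1), of v] x(2) unfolding l(2) r_def by simp
  qed
  have o: "outer \<in> borel_measurable ?N"
    unfolding measurable_cong_sets[OF sets_mv_normal refl] by (rule measurable_outer)
  have Ym: "Y \<in> borel_measurable ?N" unfolding Y_def[abs_def]
    by (intro borel_measurable_scaleR borel_measurable_diff borel_measurable_const o)
  \<comment> \<open>The summed exponent depends on the sample only through the scatter matrix, so
    expectations can be carried from the product space to \<open>M\<close> through the law of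
    \<open>S\<close>.\<close>
  define T where "T X = l *\<^sub>R (\<sigma> *\<^sub>R (X - real n *\<^sub>R C))" for X
  have T: "(\<Sum>k<n. Y (\<xi> k)) = T (scatter_matrix n \<xi>)" for \<xi>
    unfolding Y_def T_def scatter_matrix_eq
    by (simp add: sum_subtractf scaleR_sum_right[symmetric] sum_constant_scaleR del: sum_constant)
  have Tm [measurable]: "T \<in> borel_measurable borel" unfolding T_def[abs_def] by measurable
  have fm [measurable]: "(\<lambda>X. ennreal (trace (mexp (T X)))) \<in> borel_measurable borel" by measurable
  have "(\<integral>\<^sup>+\<omega>. ennreal (trace (mexp (T (S \<omega>)))) \<partial>M)
      = (\<integral>\<^sup>+X. ennreal (trace (mexp (T X))) \<partial>wishart n C)"
    unfolding S(2)[symmetric] by (subst nn_integral_distr[OF S(1)]) (use fm in simp_all)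
  also have "\<dots> = (\<integral>\<^sup>+\<xi>. ennreal (trace (mexp (\<Sum>k<n. Y (\<xi> k)))) \<partial>(\<Pi>\<^sub>M k\<in>{..<n}. ?N))"
    unfolding wishart_def T by (subst nn_integral_distr[OF measurable_scatter_matrix]) (use fm in simp_all)
  also have "\<dots> \<le> ennreal (real CARD('d) * (1 + K) ^ card {..<n})"
    using K by (intro trace_mexp_sum_le prob_space_mv_normal Ym symY mgf) auto
  finally have tot: "(\<integral>\<^sup>+\<omega>. ennreal (trace (mexp (T (S \<omega>)))) \<partial>M) \<le> ennreal (real CARD('d) * (1 + K) ^ n)"
    by simp
  let ?c = "x * real n * t"
  define B where "B = {\<omega> \<in> space M. 1 \<le> ennreal (exp (- ?c)) * ennreal (trace (mexp (T (S \<omega>))))}"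
  have fS [measurable]: "(\<lambda>\<omega>. ennreal (trace (mexp (T (S \<omega>))))) \<in> borel_measurable M"
    using measurable_compose[OF S(1) fm] .
  have B: "B \<in> sets M" unfolding B_def by measurable
  have "emeasure M B \<le> ennreal (exp (- ?c)) * (\<integral>\<^sup>+\<omega>. ennreal (trace (mexp (T (S \<omega>)))) * indicator (space M) \<omega> \<partial>M)"
    unfolding B_def by (rule nn_integral_Markov_inequality) auto
  also have "(\<integral>\<^sup>+\<omega>. ennreal (trace (mexp (T (S \<omega>)))) * indicator (space M) \<omega> \<partial>M)
      = (\<integral>\<^sup>+\<omega>. ennreal (trace (mexp (T (S \<omega>)))) \<partial>M)"
    by (rule nn_integral_cong) simp
  also have "ennreal (exp (- ?c)) * \<dots> \<le> ennreal (exp (- ?c)) * ennreal (real CARD('d) * (1 + K) ^ n)"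
    by (intro mult_left_mono tot) simp
  also have "\<dots> = ennreal (exp (- ?c) * (real CARD('d) * (1 + K) ^ n))"
    using K by (intro ennreal_mult[symmetric]) auto
  finally have "measure M B \<le> exp (- ?c) * (real CARD('d) * (1 + K) ^ n)"
    unfolding emeasure_eq_measure using K by simp
  \<comment> \<open>By \<open>1 + K \<le> exp K\<close> the bound becomes a single exponential, with
    the exponent that was minimised.\<close>
  also have "\<dots> \<le> exp (- ?c) * (real CARD('d) * exp K ^ n)"
    using K by (intro mult_left_mono power_mono) auto
  also have "\<dots> = real CARD('d) * exp (real n * K - ?c)"
    unfolding exp_of_nat_mult[symmetric]
    by (simp add: exp_diff exp_minus divide_inverse mult_ac)
  also have "real n * K - ?c = - \<theta>" using ex by (simp add: K_def)
  finally have mB: "measure M B \<le> real CARD('d) * exp (- \<theta>)" .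
  have "AE X in distr M borel S. symmetric_mat X" unfolding S(2) by (rule AE_wishart_symmetric)
  from AE_distrD[OF S(1) this] have "AE \<omega> in M. t * L \<le> eigval 1 (\<sigma> *\<^sub>R ((1 / real n) *\<^sub>R S \<omega> - C)) \<longrightarrow> \<omega> \<in> B"
    using AE_space
  proof eventually_elim
    case (elim \<omega>)
    show ?case
    proof
      let ?Z = "\<sigma> *\<^sub>R ((1 / real n) *\<^sub>R S \<omega> - C)"
      assume le: "t * L \<le> eigval 1 ?Z"
      have "symmetric_mat ?Z" by (intro symmetric_mat_combine C elim)
      from exp_le_trace_mexp[OF this _ le, of "l * real n"]
      have "exp (l * real n * (t * L)) \<le> trace (mexp ((l * real n) *\<^sub>R ?Z))" using l by simp
      also have "(l * real n) *\<^sub>R ?Z = T (S \<omega>)"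
        using n by (simp add: T_def scaleR_diff_right mult_ac)
      also have "l * real n * (t * L) = ?c" using L by (simp add: l_def)
      finally have "exp (- ?c) * exp ?c \<le> exp (- ?c) * trace (mexp (T (S \<omega>)))"
        by (intro mult_left_mono) auto
      then have "1 \<le> exp (- ?c) * trace (mexp (T (S \<omega>)))" by (simp add: exp_minus)
      then have "ennreal 1 \<le> ennreal (exp (- ?c) * trace (mexp (T (S \<omega>))))" by (rule ennreal_leI)
      then show "\<omega> \<in> B" unfolding B_def using elim by (simp add: ennreal_mult')
    qed
  qed
  then show ?thesis using that[OF B mB] unfolding t_def L_def by blast
qed

theorem theorem1:
  fixes M :: "'w measure"
    and S :: "'w \<Rightarrow> real^'d^'d"
    and C :: "real^'d^'d"
    and n :: nat
    and \<theta> r :: real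
    and \<kappa> :: "nat \<Rightarrow> real"
  assumes "prob_space M"
    and "n \<ge> 1"
    and "symmetric_mat C" and "pos_semidef C" and "C \<noteq> 0"
    and "S \<in> borel_measurable M" and "distr M borel S = wishart n C"
    and "\<theta> \<ge> 0"
    and "r = trace C / spectral_norm C"
    and "\<And>l. l \<in> {1..CARD('d)} \<Longrightarrow> \<kappa> l = eigval 1 C / eigval l C"
  shows "\<P>(\<omega> in M. eigval 1 ((1 / real n) *\<^sub>R S \<omega> - C)
             \<ge> (sqrt (2 * \<theta> * (r + 1) / real n) + 2 * \<theta> * r / real n) * eigval 1 C)
           \<le> real CARD('d) * exp (- \<theta>)
       \<and> \<P>(\<omega> in M. eigval 1 (C - (1 / real n) *\<^sub>R S \<omega>)
             \<ge> (sqrt (2 * \<theta> * (r + 1) / real n) + 2 * \<theta> * r / real n) * eigval 1 C)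
           \<le> real CARD('d) * exp (- \<theta>)
       \<and> \<P>(\<omega> in M. spectral_norm ((1 / real n) *\<^sub>R S \<omega> - C)
             \<ge> (sqrt (2 * \<theta> * (r + 1) / real n) + 2 * \<theta> * r / real n) * spectral_norm C)
           \<le> 2 * real CARD('d) * exp (- \<theta>)
       \<and> (eigval CARD('d) C > 0 \<longrightarrow>
         \<P>(\<omega> in M. \<forall>l\<in>{1..CARD('d)}.
             \<bar>eigval l ((1 / real n) *\<^sub>R S \<omega>) - eigval l C\<bar>
             \<ge> (sqrt (2 * \<theta> * (\<kappa> l)\<^sup>2 * (r + 1) / real n) + 2 * \<theta> * \<kappa> l * r / real n)
                 * eigval l C)
           \<le> 2 * real CARD('d) * exp (- \<theta>))"
proof -
  interpret prob_space M by (rule assms(1))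
  let ?b = "real CARD('d) * exp (- \<theta>)"
  let ?S = "\<lambda>\<omega>. (1 / real n) *\<^sub>R S \<omega>"
  define t where "t = (sqrt (2 * \<theta> * (r + 1) / real n) + 2 * \<theta> * r / real n) * eigval 1 C"
  have sn: "spectral_norm C = eigval 1 C" by (rule spectral_norm_psd[OF assms(3,4)])
  have L: "0 < eigval 1 C" by (rule eigval_1_pos[OF assms(3-5)])
  have r: "trace C / eigval 1 C = r" using assms(9) sn by simp
  have dev: "\<exists>B. B \<in> sets M \<and> measure M B \<le> ?b \<and>
      (AE \<omega> in M. t \<le> eigval 1 (\<sigma> *\<^sub>R (?S \<omega> - C)) \<longrightarrow> \<omega> \<in> B)" if "\<sigma> = 1 \<or> \<sigma> = -1" for \<sigma> :: real
    by (rule wishart_one_sided_deviation[OF assms(1-8) that]) (unfold r t_def, blast)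
  obtain B1 where B1: "B1 \<in> sets M" "measure M B1 \<le> ?b"
    and up: "AE \<omega> in M. t \<le> eigval 1 (?S \<omega> - C) \<longrightarrow> \<omega> \<in> B1"
    using dev[of 1] unfolding scaleR_one by blast
  obtain B2 where B2: "B2 \<in> sets M" "measure M B2 \<le> ?b"
    and lo: "AE \<omega> in M. t \<le> eigval 1 (C - ?S \<omega>) \<longrightarrow> \<omega> \<in> B2"
    using dev[of "-1"] unfolding scaleR_minus1_left minus_diff_eq by blast
  have U: "B1 \<union> B2 \<in> sets M" using B1 B2 by simp
  have mU: "measure M (B1 \<union> B2) \<le> 2 * ?b"
    using measure_Un_le[OF B1(1) B2(1)] B1(2) B2(2) by linarith
  have "AE X in distr M borel S. symmetric_mat X" unfolding assms(7) by (rule AE_wishart_symmetric)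
  from AE_distrD[OF assms(6) this] have symS: "AE \<omega> in M. symmetric_mat (?S \<omega>)"
    by (rule eventually_mono) (rule symmetric_mat_combine(3))
  \<comment> \<open>Monotonicity of the measure asks for measurability of the larger set, which is
    what the covering sets \<open>B1\<close> and \<open>B2\<close> provide.\<close>
  have 1: "\<P>(\<omega> in M. t \<le> eigval 1 (?S \<omega> - C)) \<le> ?b"
    by (rule order_trans[OF finite_measure_mono_AE[OF _ B1(1)] B1(2)]) (use up in auto)
  have 2: "\<P>(\<omega> in M. t \<le> eigval 1 (C - ?S \<omega>)) \<le> ?b"
    by (rule order_trans[OF finite_measure_mono_AE[OF _ B2(1)] B2(2)]) (use lo in auto)
  have 3: "\<P>(\<omega> in M. t \<le> spectral_norm (?S \<omega> - C)) \<le> 2 * ?b"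
  proof (rule order_trans[OF finite_measure_mono_AE[OF _ U] mU])
    show "AE \<omega> in M. \<omega> \<in> {\<omega> \<in> space M. t \<le> spectral_norm (?S \<omega> - C)} \<longrightarrow> \<omega> \<in> B1 \<union> B2"
      using symS up lo
    proof eventually_elim
      case (elim \<omega>)
      have "spectral_norm (?S \<omega> - C) \<le> max (eigval 1 (?S \<omega> - C)) (eigval 1 (C - ?S \<omega>))"
        by (rule spectral_norm_le_eigval_1[OF symmetric_mat_combine(2)[OF elim(1) assms(3)]]) simp_all
      then show ?case using elim(2,3) by auto
    qed
  qed
  have 4: "\<P>(\<omega> in M. \<forall>l\<in>{1..CARD('d)}. \<bar>eigval l (?S \<omega>) - eigval l C\<bar>
      \<ge> (sqrt (2 * \<theta> * (\<kappa> l)\<^sup>2 * (r + 1) / real n) + 2 * \<theta> * \<kappa> l * r / real n) * eigval l C) \<le> 2 * ?b"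
  proof (rule order_trans[OF finite_measure_mono_AE[OF _ U] mU])
    have one: "1 \<in> {1..CARD('d)}" by simp
    have \<kappa>: "\<kappa> 1 = 1" using assms(10)[OF one] L by simp
    show "AE \<omega> in M. \<omega> \<in> {\<omega> \<in> space M. \<forall>l\<in>{1..CARD('d)}. \<bar>eigval l (?S \<omega>) - eigval l C\<bar>
      \<ge> (sqrt (2 * \<theta> * (\<kappa> l)\<^sup>2 * (r + 1) / real n) + 2 * \<theta> * \<kappa> l * r / real n) * eigval l C}
      \<longrightarrow> \<omega> \<in> B1 \<union> B2"
      using symS up lo
    proof eventually_elim
      case (elim \<omega>)
      show ?case
      proof
        assume "\<omega> \<in> {\<omega> \<in> space M. \<forall>l\<in>{1..CARD('d)}. \<bar>eigval l (?S \<omega>) - eigval l C\<bar>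
          \<ge> (sqrt (2 * \<theta> * (\<kappa> l)\<^sup>2 * (r + 1) / real n) + 2 * \<theta> * \<kappa> l * r / real n) * eigval l C}"
        \<comment> \<open>The event is an intersection over \<open>l\<close>, so it lies inside its
          instance at \<open>l = 1\<close>; Weyl's inequality in both orders sends that instance
          into the two one-sided events.\<close>
        then have "\<bar>eigval 1 (?S \<omega>) - eigval 1 C\<bar>
          \<ge> (sqrt (2 * \<theta> * (\<kappa> 1)\<^sup>2 * (r + 1) / real n) + 2 * \<theta> * \<kappa> 1 * r / real n) * eigval 1 C"
          using one by blast
        then have "t \<le> \<bar>eigval 1 (?S \<omega>) - eigval 1 C\<bar>" unfolding \<kappa> t_def by simp
        then show "\<omega> \<in> B1 \<union> B2"
          using eigval_1_diff_le[OF elim(1) assms(3)] eigval_1_diff_le[OF assms(3) elim(1)] elim(2,3)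
          by (auto simp: abs_if split: if_splits)
      qed
    qed
  qed
  show ?thesis using 1 2 3 4 unfolding sn t_def by (simp add: mult.assoc)
qed

end
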